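(* Let $H$ be a Hopf algebra over a field $k$. Assume there exists a coalgebra basis $\mathcal B$ of $H$. Then $\{\varepsilon(b)^{-1}b\mid b\in\mathcal B\}=G(H)$, the group of group-like elements of $H$. Moreover, $H\cong k[G(H)]$.
   Context: A basis $\mathcal B$ of a coalgebra $(C,\Delta,\varepsilon)$ over $k$ is called a coalgebra basis if for every $b\in\mathcal B$ there are $\lambda\in k^*$ and $b_1,b_2\in\mathcal B$ with $\Delta(b)=\lambda\, b_1\otimes b_2$. (The nonvanishing of $\varepsilon(b)$ for $b\in\mathcal B$ is part of the assertion.) $k[G(H)]$ is the group algebra with its usual Hopf algebra structure, and the isomorphism is one of Hopf algebras. *)

theory Defs
  imports "Jordan_Normal_Form.Missing_VectorSpace" "HOL-Algebra.QuotRing"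
begin

text \<open>
  Vector spaces over a field \<open>K\<close> are the carrier-based ones of \<open>VectorSpace\<close> (records of type
  \<open>module\<close>, so every vector space record also has \<open>mult\<close> and \<open>one\<close> fields, which are
  meaningless unless the space is an algebra).  There is no tensor product in the libraries; it
  is constructed below as a quotient of a free vector space.
\<close>

section \<open>Monoid algebras\<close>

definition monoid_basis :: "('a, 'r) ring_scheme \<Rightarrow> 'g \<Rightarrow> 'g \<Rightarrow> 'a" where
  "monoid_basis K g = (\<lambda>x. if x = g then \<one>\<^bsub>K\<^esub> else \<zero>\<^bsub>K\<^esub>)"

text \<open>
  The monoid algebra \<open>K[G]\<close>: finitely supported functions on \<open>G\<close> with convolution.  Its vector
  space structure is that of the free vector space on the set \<open>carrier G\<close> and does not depend on
  the operations of \<open>G\<close>.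
\<close>

definition monoid_algebra ::
  "('a, 'r) ring_scheme \<Rightarrow> ('g, 'n) monoid_scheme \<Rightarrow> ('a, 'g \<Rightarrow> 'a) module" where
  "monoid_algebra K G =
    \<lparr>carrier = {\<phi>. range \<phi> \<subseteq> carrier K \<and> finite {x. \<phi> x \<noteq> \<zero>\<^bsub>K\<^esub>} \<and> {x. \<phi> x \<noteq> \<zero>\<^bsub>K\<^esub>} \<subseteq> carrier G},
     mult = (\<lambda>\<phi> \<psi> z. \<Oplus>\<^bsub>K\<^esub>x\<in>{x. \<phi> x \<noteq> \<zero>\<^bsub>K\<^esub>}. \<Oplus>\<^bsub>K\<^esub>y\<in>{y. \<psi> y \<noteq> \<zero>\<^bsub>K\<^esub>}.
       (if x \<otimes>\<^bsub>G\<^esub> y = z then \<phi> x \<otimes>\<^bsub>K\<^esub> \<psi> y else \<zero>\<^bsub>K\<^esub>)),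
     one = monoid_basis K \<one>\<^bsub>G\<^esub>,
     zero = (\<lambda>x. \<zero>\<^bsub>K\<^esub>),
     add = (\<lambda>\<phi> \<psi> x. \<phi> x \<oplus>\<^bsub>K\<^esub> \<psi> x),
     smult = (\<lambda>c \<phi> x. c \<otimes>\<^bsub>K\<^esub> \<phi> x)\<rparr>"

text \<open>The linear map on a free vector space which is given by \<open>f\<close> on the basis elements.\<close>

definition lin_ext ::
  "('a, 'r) ring_scheme \<Rightarrow> ('a, 'c, 'm) module_scheme \<Rightarrow> ('g \<Rightarrow> 'c) \<Rightarrow> ('g \<Rightarrow> 'a) \<Rightarrow> 'c" where
  "lin_ext K M f \<phi> = (\<Oplus>\<^bsub>M\<^esub>x\<in>{x. \<phi> x \<noteq> \<zero>\<^bsub>K\<^esub>}. \<phi> x \<odot>\<^bsub>M\<^esub> f x)"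

definition self_module :: "('a, 'r) ring_scheme \<Rightarrow> ('a, 'a) module" where
  "self_module K = \<lparr>carrier = carrier K, mult = mult K, one = \<one>\<^bsub>K\<^esub>, zero = \<zero>\<^bsub>K\<^esub>,
     add = add K, smult = mult K\<rparr>"


section \<open>Tensor products\<close>

text \<open>
  The tensor product \<open>A \<otimes> B\<close> is the free vector space on \<open>carrier A \<times> carrier B\<close> modulo the
  subspace spanned by the bilinearity relations.  When \<open>A\<close> and \<open>B\<close> are algebras, the free space
  is the monoid algebra of the product of their multiplicative monoids and the relations span an
  ideal, so the factor ring carries the usual multiplication
  \<open>(a \<otimes> b) (a' \<otimes> b') = a a' \<otimes> b b'\<close>.
\<close>

abbreviation free_prod ::
  "('a, 'r) ring_scheme \<Rightarrow> ('a, 'b, 'm) module_scheme \<Rightarrow> ('a, 'c, 'n) module_scheme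
    \<Rightarrow> ('a, 'b \<times> 'c \<Rightarrow> 'a) module" where
  "free_prod K A B \<equiv> monoid_algebra K (A \<times>\<times> B)"

definition bilin_rels ::
  "('a, 'r) ring_scheme \<Rightarrow> ('a, 'b, 'm) module_scheme \<Rightarrow> ('a, 'c, 'n) module_scheme
    \<Rightarrow> ('b \<times> 'c \<Rightarrow> 'a) set" where
  "bilin_rels K A B =
    (let F = free_prod K A B; e = (\<lambda>a b. monoid_basis K (a, b)) in
      {e (a \<oplus>\<^bsub>A\<^esub> a') b \<ominus>\<^bsub>F\<^esub> (e a b \<oplus>\<^bsub>F\<^esub> e a' b) | a a' b.
         a \<in> carrier A \<and> a' \<in> carrier A \<and> b \<in> carrier B} \<union>
      {e a (b \<oplus>\<^bsub>B\<^esub> b') \<ominus>\<^bsub>F\<^esub> (e a b \<oplus>\<^bsub>F\<^esub> e a b') | a b b'.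
         a \<in> carrier A \<and> b \<in> carrier B \<and> b' \<in> carrier B} \<union>
      {e (c \<odot>\<^bsub>A\<^esub> a) b \<ominus>\<^bsub>F\<^esub> c \<odot>\<^bsub>F\<^esub> e a b | c a b.
         c \<in> carrier K \<and> a \<in> carrier A \<and> b \<in> carrier B} \<union>
      {e a (c \<odot>\<^bsub>B\<^esub> b) \<ominus>\<^bsub>F\<^esub> c \<odot>\<^bsub>F\<^esub> e a b | c a b.
         c \<in> carrier K \<and> a \<in> carrier A \<and> b \<in> carrier B})"

definition tensor_null ::
  "('a, 'r) ring_scheme \<Rightarrow> ('a, 'b, 'm) module_scheme \<Rightarrow> ('a, 'c, 'n) module_scheme
    \<Rightarrow> ('b \<times> 'c \<Rightarrow> 'a) set" where
  "tensor_null K A B = LinearCombinations.module.span K (free_prod K A B) (bilin_rels K A B)"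

definition tensor ::
  "('a, 'r) ring_scheme \<Rightarrow> ('a, 'b, 'm) module_scheme \<Rightarrow> ('a, 'c, 'n) module_scheme
    \<Rightarrow> ('a, ('b \<times> 'c \<Rightarrow> 'a) set) module" where
  "tensor K A B =
    (let F = free_prod K A B; N = tensor_null K A B in
      \<lparr>carrier = carrier (F Quot N), mult = mult (F Quot N), one = \<one>\<^bsub>F Quot N\<^esub>,
       zero = \<zero>\<^bsub>F Quot N\<^esub>, add = add (F Quot N),
       smult = (\<lambda>c X. \<Union>\<phi>\<in>X. N +>\<^bsub>F\<^esub> (c \<odot>\<^bsub>F\<^esub> \<phi>))\<rparr>)"

definition pure_tensor ::
  "('a, 'r) ring_scheme \<Rightarrow> ('a, 'b, 'm) module_scheme \<Rightarrow> ('a, 'c, 'n) module_scheme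
    \<Rightarrow> 'b \<Rightarrow> 'c \<Rightarrow> ('b \<times> 'c \<Rightarrow> 'a) set" where
  "pure_tensor K A B a b = tensor_null K A B +>\<^bsub>free_prod K A B\<^esub> monoid_basis K (a, b)"

text \<open>
  The linear map \<open>A \<otimes> B \<rightarrow> M\<close> with \<open>a \<otimes> b \<mapsto> \<beta> a b\<close>, for bilinear \<open>\<beta>\<close>: it sends a class to
  the common value of the linear extension of \<open>\<beta>\<close> on all its representatives.
\<close>

definition tensor_lift ::
  "('a, 'r) ring_scheme \<Rightarrow> ('a, 'd, 'm) module_scheme \<Rightarrow> ('b \<Rightarrow> 'c \<Rightarrow> 'd)
    \<Rightarrow> ('b \<times> 'c \<Rightarrow> 'a) set \<Rightarrow> 'd" where
  "tensor_lift K M \<beta> X = the_elem (lin_ext K M (\<lambda>(a, b). \<beta> a b) ` X)"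

text \<open>The map \<open>f \<otimes> g\<close> into \<open>A \<otimes> B\<close> (the domain is determined by \<open>f\<close> and \<open>g\<close>).\<close>

definition tensor_map ::
  "('a, 'r) ring_scheme \<Rightarrow> ('a, 'b, 'm) module_scheme \<Rightarrow> ('a, 'c, 'n) module_scheme
    \<Rightarrow> ('d \<Rightarrow> 'b) \<Rightarrow> ('e \<Rightarrow> 'c) \<Rightarrow> ('d \<times> 'e \<Rightarrow> 'a) set \<Rightarrow> ('b \<times> 'c \<Rightarrow> 'a) set" where
  "tensor_map K A B f g = tensor_lift K (tensor K A B) (\<lambda>a b. pure_tensor K A B (f a) (g b))"

text \<open>The associativity isomorphism \<open>(A \<otimes> B) \<otimes> C \<rightarrow> A \<otimes> (B \<otimes> C)\<close>.\<close>

definition tensor_assoc ::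
  "('a, 'r) ring_scheme \<Rightarrow> ('a, 'b, 'm) module_scheme \<Rightarrow> ('a, 'c, 'n) module_scheme
    \<Rightarrow> ('a, 'd, 'p) module_scheme
    \<Rightarrow> (('b \<times> 'c \<Rightarrow> 'a) set \<times> 'd \<Rightarrow> 'a) set \<Rightarrow> ('b \<times> ('c \<times> 'd \<Rightarrow> 'a) set \<Rightarrow> 'a) set" where
  "tensor_assoc K A B C =
    (let T = tensor K A (tensor K B C) in
      tensor_lift K T (\<lambda>t c.
        tensor_lift K T (\<lambda>a b. pure_tensor K A (tensor K B C) a (pure_tensor K B C b c)) t))"


section \<open>Hopf algebras\<close>

record ('a, 'b) coalgebra = "('a, 'b) module" +
  comult :: "'b \<Rightarrow> ('b \<times> 'b \<Rightarrow> 'a) set" (\<open>\<Delta>\<index>\<close>)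
  counit :: "'b \<Rightarrow> 'a" (\<open>\<epsilon>\<index>\<close>)

record ('a, 'b) hopf_algebra = "('a, 'b) coalgebra" +
  antipode :: "'b \<Rightarrow> 'b"

locale coalgebra = vectorspace K C
  for K :: "('a, 'r) ring_scheme" and C :: "('a, 'b, 'm) coalgebra_scheme" (structure) +
  assumes comult_linear: "\<Delta> \<in> module_hom K C (tensor K C C)"
    and counit_linear: "\<epsilon> \<in> module_hom K C (self_module K)"
    and coassoc: "x \<in> carrier C \<Longrightarrow>
      tensor_assoc K C C C (tensor_map K (tensor K C C) C \<Delta> (\<lambda>c. c) (\<Delta> x))
        = tensor_map K C (tensor K C C) (\<lambda>c. c) \<Delta> (\<Delta> x)"
    and counit_left: "x \<in> carrier C \<Longrightarrow> tensor_lift K C (\<lambda>a b. \<epsilon> a \<odot> b) (\<Delta> x) = x"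
    and counit_right: "x \<in> carrier C \<Longrightarrow> tensor_lift K C (\<lambda>a b. \<epsilon> b \<odot> a) (\<Delta> x) = x"

text \<open>The locale \<open>algebra\<close> of \<open>HOL-Algebra\<close> is restricted to commutative algebras.\<close>

locale assoc_algebra = vectorspace K A + A?: ring A for K and A (structure) +
  assumes smult_mult_left:
      "\<lbrakk>c \<in> carrier K; x \<in> carrier A; y \<in> carrier A\<rbrakk> \<Longrightarrow> (c \<odot> x) \<otimes> y = c \<odot> (x \<otimes> y)"
    and smult_mult_right:
      "\<lbrakk>c \<in> carrier K; x \<in> carrier A; y \<in> carrier A\<rbrakk> \<Longrightarrow> x \<otimes> (c \<odot> y) = c \<odot> (x \<otimes> y)"

locale bialgebra = coalgebra K H + assoc_algebra K H for K and H (structure) +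
  assumes comult_ring_hom: "\<Delta> \<in> ring_hom H (tensor K H H)"
    and counit_ring_hom: "\<epsilon> \<in> ring_hom H K"

locale hopf_algebra = bialgebra K H
  for K :: "('a, 'r) ring_scheme" and H :: "('a, 'b, 'm) hopf_algebra_scheme" (structure) +
  assumes antipode_linear: "antipode H \<in> module_hom K H H"
    and antipode_left: "x \<in> carrier H \<Longrightarrow>
      tensor_lift K H (\<lambda>a b. antipode H a \<otimes> b) (\<Delta> x) = \<epsilon> x \<odot> \<one>"
    and antipode_right: "x \<in> carrier H \<Longrightarrow>
      tensor_lift K H (\<lambda>a b. a \<otimes> antipode H b) (\<Delta> x) = \<epsilon> x \<odot> \<one>"

definition hopf_iso ::
  "('a, 'r) ring_scheme \<Rightarrow> ('a, 'b, 'm) hopf_algebra_scheme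
    \<Rightarrow> ('a, 'c, 'n) hopf_algebra_scheme \<Rightarrow> ('b \<Rightarrow> 'c) set" where
  "hopf_iso K H L = {f. bij_betw f (carrier H) (carrier L) \<and>
     f \<in> module_hom K H L \<and> f \<in> ring_hom H L \<and>
     (\<forall>x\<in>carrier H. \<Delta>\<^bsub>L\<^esub> (f x) = tensor_map K L L f f (\<Delta>\<^bsub>H\<^esub> x)) \<and>
     (\<forall>x\<in>carrier H. \<epsilon>\<^bsub>L\<^esub> (f x) = \<epsilon>\<^bsub>H\<^esub> x) \<and>
     (\<forall>x\<in>carrier H. antipode L (f x) = f (antipode H x))}"

definition hopf_isomorphic ::
  "('a, 'r) ring_scheme \<Rightarrow> ('a, 'b, 'm) hopf_algebra_scheme
    \<Rightarrow> ('a, 'c, 'n) hopf_algebra_scheme \<Rightarrow> bool" where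
  "hopf_isomorphic K H L \<longleftrightarrow> hopf_iso K H L \<noteq> {}"


section \<open>Group-like elements, group algebras and coalgebra bases\<close>

definition grouplike_group ::
  "('a, 'r) ring_scheme \<Rightarrow> ('a, 'b, 'm) coalgebra_scheme \<Rightarrow> 'b monoid" where
  "grouplike_group K H =
    \<lparr>carrier = {g \<in> carrier H. \<Delta>\<^bsub>H\<^esub> g = pure_tensor K H H g g \<and> \<epsilon>\<^bsub>H\<^esub> g = \<one>\<^bsub>K\<^esub>},
     mult = mult H, one = \<one>\<^bsub>H\<^esub>\<rparr>"

text \<open>\<open>\<Delta> g = g \<otimes> g\<close>, \<open>\<epsilon> g = 1\<close> and \<open>S g = g\<inverse>\<close> for \<open>g \<in> G\<close>, extended linearly.\<close>

definition group_algebra ::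
  "('a, 'r) ring_scheme \<Rightarrow> ('g, 'n) monoid_scheme \<Rightarrow> ('a, 'g \<Rightarrow> 'a) hopf_algebra" where
  "group_algebra K G =
    (let A = monoid_algebra K G; e = monoid_basis K in
      \<lparr>carrier = carrier A, mult = mult A, one = \<one>\<^bsub>A\<^esub>, zero = \<zero>\<^bsub>A\<^esub>, add = add A, smult = smult A,
       comult = lin_ext K (tensor K A A) (\<lambda>g. pure_tensor K A A (e g) (e g)),
       counit = lin_ext K (self_module K) (\<lambda>g. \<one>\<^bsub>K\<^esub>),
       antipode = lin_ext K A (\<lambda>g. e (inv\<^bsub>G\<^esub> g))\<rparr>)"

definition coalgebra_basis ::
  "('a, 'r) ring_scheme \<Rightarrow> ('a, 'b, 'm) coalgebra_scheme \<Rightarrow> 'b set \<Rightarrow> bool" where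
  "coalgebra_basis K C B \<longleftrightarrow>
    vectorspace.basis K C B \<and>
    (\<forall>b\<in>B. \<exists>c\<in>carrier K - {\<zero>\<^bsub>K\<^esub>}. \<exists>b1\<in>B. \<exists>b2\<in>B.
      \<Delta>\<^bsub>C\<^esub> b = c \<odot>\<^bsub>tensor K C C\<^esub> pure_tensor K C C b1 b2)"

end

theory Submission
  imports Defs
begin

text \<open>
  The counit axioms force \<open>\<Delta> b = (\<epsilon> b)\<^sup>-\<^sup>1 b \<otimes> b\<close> for \<open>b \<in> B\<close>, so the rescaled elements
  \<open>(\<epsilon> b)\<^sup>-\<^sup>1 b\<close> are group-like and still form a basis.  Comparing coordinates in
  \<open>\<Delta> g = g \<otimes> g\<close> shows that every group-like \<open>g\<close> is one of them.  Hence \<open>G(H)\<close> is a basis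
  of \<open>H\<close>, and the coordinate map \<open>H \<rightarrow> K[G(H)]\<close> respects all operations because it does so
  on \<open>G(H)\<close>.
\<close>

text \<open>Elements of the tensor square are cosets of finitely supported functions on pairs, and
  \<open>tensor_lift\<close> takes the common value of a linear extension on such a coset. So before
  a counit axiom or the equation \<open>\<Delta> g = g \<otimes> g\<close> can be evaluated, each
  map on the tensor square has to be traced back to a bilinear one. No basis of
  \<open>H \<otimes> H\<close> is constructed: comparing coordinates there is done by functionals
  lifted from products of two coordinates with respect to \<open>B\<close>. That G(H) is a basis is
  established before it is known to be a group, because the inverse of a group-like \<open>g\<close>
  is found by expanding the antipode of \<open>g\<close> in this basis. The isomorphism is the
  inverse of the evaluation map from formal to actual linear combinations, so bijectivity and
  linearity come together, and multiplicativity is checked on the evaluation side, where both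
  factors range over a free module.\<close>

lemma module_homI:
  assumes "\<And>x. x \<in> carrier M \<Longrightarrow> f x \<in> carrier N"
    and "\<And>x y. \<lbrakk>x \<in> carrier M; y \<in> carrier M\<rbrakk> \<Longrightarrow> f (x \<oplus>\<^bsub>M\<^esub> y) = f x \<oplus>\<^bsub>N\<^esub> f y"
    and "\<And>c x. \<lbrakk>c \<in> carrier R; x \<in> carrier M\<rbrakk> \<Longrightarrow> f (c \<odot>\<^bsub>M\<^esub> x) = c \<odot>\<^bsub>N\<^esub> f x"
  shows "f \<in> module_hom R M N"
  using assms by (auto simp: module_hom_def)

lemma module_hom_in:
  "\<lbrakk>f \<in> module_hom R M N; x \<in> carrier M\<rbrakk> \<Longrightarrow> f x \<in> carrier N"
  by (auto simp: module_hom_def)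

lemma module_hom_comp:
  assumes "f \<in> module_hom R L M" "g \<in> module_hom R M N"
  shows "(\<lambda>x. g (f x)) \<in> module_hom R L N"
  using assms by (auto simp: module_hom_def Pi_def)

lemma module_hom_id: "(\<lambda>x. x) \<in> module_hom R M M"
  by (auto simp: module_hom_def)

lemma mod_homI:
  "\<lbrakk>module R M; module R N; f \<in> module_hom R M N\<rbrakk> \<Longrightarrow> mod_hom R M N f"
  by (simp add: mod_hom_def mod_hom_axioms_def)

lemma (in module) smult_hom:
  assumes "c \<in> carrier R"
  shows "(\<lambda>x. c \<odot>\<^bsub>M\<^esub> x) \<in> module_hom R M M"
  using assms by (intro module_homI)
    (auto simp: smult_r_distr smult_assoc1[symmetric] R.m_comm)

section \<open>Free modules\<close>

lemma monoid_algebra_carrier_iff: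
  "\<phi> \<in> carrier (monoid_algebra K G) \<longleftrightarrow> range \<phi> \<subseteq> carrier K \<and>
    finite {x. \<phi> x \<noteq> \<zero>\<^bsub>K\<^esub>} \<and> {x. \<phi> x \<noteq> \<zero>\<^bsub>K\<^esub>} \<subseteq> carrier G"
  by (simp add: monoid_algebra_def)

lemma monoid_algebra_simps:
  "\<zero>\<^bsub>monoid_algebra K G\<^esub> = (\<lambda>x. \<zero>\<^bsub>K\<^esub>)"
  "\<phi> \<oplus>\<^bsub>monoid_algebra K G\<^esub> \<psi> = (\<lambda>x. \<phi> x \<oplus>\<^bsub>K\<^esub> \<psi> x)"
  "c \<odot>\<^bsub>monoid_algebra K G\<^esub> \<phi> = (\<lambda>x. c \<otimes>\<^bsub>K\<^esub> \<phi> x)"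
  "\<one>\<^bsub>monoid_algebra K G\<^esub> = monoid_basis K \<one>\<^bsub>G\<^esub>"
  by (simp_all add: monoid_algebra_def)

lemma (in cring) module_monoid_algebra: "module R (monoid_algebra R G)"
proof -
  let ?F = "monoid_algebra R G"
  have add: "(\<lambda>x. \<phi> x \<oplus> \<psi> x) \<in> carrier ?F"
    if "\<phi> \<in> carrier ?F" "\<psi> \<in> carrier ?F" for \<phi> \<psi> :: "'c \<Rightarrow> 'a"
  proof -
    have "{x. \<phi> x \<oplus> \<psi> x \<noteq> \<zero>} \<subseteq> {x. \<phi> x \<noteq> \<zero>} \<union> {x. \<psi> x \<noteq> \<zero>}"
      by auto
    then show ?thesis
      using that unfolding monoid_algebra_carrier_iff
      by (auto intro: finite_subset[OF _ finite_UnI] simp: image_subset_iff)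
  qed
  have smult: "(\<lambda>x. c \<otimes> \<phi> x) \<in> carrier ?F"
    if "c \<in> carrier R" "\<phi> \<in> carrier ?F" for c and \<phi> :: "'c \<Rightarrow> 'a"
  proof -
    have "{x. c \<otimes> \<phi> x \<noteq> \<zero>} \<subseteq> {x. \<phi> x \<noteq> \<zero>}"
      using that by auto
    then show ?thesis
      using that unfolding monoid_algebra_carrier_iff
      by (auto intro: finite_subset simp: image_subset_iff)
  qed
  have val: "\<phi> x \<in> carrier R" if "\<phi> \<in> carrier ?F" for \<phi> x
    using that by (auto simp: monoid_algebra_carrier_iff)
  have "abelian_group ?F"
  proof (rule abelian_groupI)
    fix \<phi> assume \<phi>: "\<phi> \<in> carrier ?F"
    have "(\<lambda>x. (\<ominus> \<one>) \<otimes> \<phi> x) \<oplus>\<^bsub>?F\<^esub> \<phi> = \<zero>\<^bsub>?F\<^esub>"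
      using val[OF \<phi>] by (auto simp: monoid_algebra_simps l_minus l_neg)
    then show "\<exists>\<psi>\<in>carrier ?F. \<psi> \<oplus>\<^bsub>?F\<^esub> \<phi> = \<zero>\<^bsub>?F\<^esub>"
      using smult[OF _ \<phi>, of "\<ominus> \<one>"] by auto
  next
    show "\<zero>\<^bsub>?F\<^esub> \<in> carrier ?F"
      by (auto simp: monoid_algebra_carrier_iff monoid_algebra_simps)
  qed (auto simp: monoid_algebra_simps add a_ac val)
  then show ?thesis
    by (intro moduleI)
      (auto simp: monoid_algebra_simps smult l_distr r_distr m_assoc val cring_axioms)
qed

lemma (in cring) monoid_algebra_val:
  "\<phi> \<in> carrier (monoid_algebra R G) \<Longrightarrow> \<phi> x \<in> carrier R"
  by (auto simp: monoid_algebra_carrier_iff)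

lemma monoid_algebra_supp:
  "\<lbrakk>\<phi> \<in> carrier (monoid_algebra K G); \<phi> x \<noteq> \<zero>\<^bsub>K\<^esub>\<rbrakk> \<Longrightarrow> x \<in> carrier G"
  by (auto simp: monoid_algebra_carrier_iff)

lemma (in cring) monoid_basis_in:
  fixes G :: "('g, 'n) monoid_scheme"
  assumes "g \<in> carrier G"
  shows "monoid_basis R g \<in> carrier (monoid_algebra R G)"
proof -
  have "{x. monoid_basis R g x \<noteq> \<zero>} \<subseteq> {g}"
    by (auto simp: monoid_basis_def)
  with assms show ?thesis
    by (auto simp: monoid_algebra_carrier_iff intro: finite_subset)
      (auto simp: monoid_basis_def)
qed

text \<open>The sum in \<open>lin_ext\<close> runs over the exact support, which can shrink under
  scaling or cancellation. A larger common index set lets the sums for \<open>\<phi>\<close>,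
  \<open>\<psi>\<close> and their sum be compared term by term.\<close>

lemma (in module) lin_ext_superset:
  assumes \<phi>: "\<phi> \<in> carrier (monoid_algebra R G)" and f: "f \<in> carrier G \<rightarrow> carrier M"
    and S: "finite S" "{x. \<phi> x \<noteq> \<zero>} \<subseteq> S" "S \<subseteq> carrier G"
  shows "lin_ext R M f \<phi> = (\<Oplus>\<^bsub>M\<^esub>x\<in>S. \<phi> x \<odot>\<^bsub>M\<^esub> f x)"
  unfolding lin_ext_def
  using S f R.monoid_algebra_val[OF \<phi>]
  by (intro M.add.finprod_mono_neutral_cong_left) (auto simp: Pi_def subset_iff)

lemma (in module) lin_ext_hom:
  assumes f: "f \<in> carrier G \<rightarrow> carrier M"
  shows "lin_ext R M f \<in> module_hom R (monoid_algebra R G) M"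
proof (rule module_homI)
  interpret F: module R "monoid_algebra R G" by (rule R.module_monoid_algebra)
  let ?F = "monoid_algebra R G"
  fix \<phi> assume \<phi>: "\<phi> \<in> carrier ?F"
  note v\<phi> = R.monoid_algebra_val[OF \<phi>]
  note s\<phi> = \<phi>[unfolded monoid_algebra_carrier_iff]
  have fin: "x \<in> {x. \<phi> x \<noteq> \<zero>} \<Longrightarrow> f x \<in> carrier M" for x
    using s\<phi> f by auto
  show "lin_ext R M f \<phi> \<in> carrier M"
    unfolding lin_ext_def using v\<phi> fin by (auto intro!: M.finsum_closed)
  {
    fix c assume c: "c \<in> carrier R"
    have "lin_ext R M f (c \<odot>\<^bsub>?F\<^esub> \<phi>) = (\<Oplus>\<^bsub>M\<^esub>x\<in>{x. \<phi> x \<noteq> \<zero>}. c \<odot>\<^bsub>M\<^esub> (\<phi> x \<odot>\<^bsub>M\<^esub> f x))"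
      using c v\<phi> fin s\<phi> F.smult_closed[OF c \<phi>]
      by (subst lin_ext_superset[OF _ f, where S = "{x. \<phi> x \<noteq> \<zero>}"])
        (auto simp: monoid_algebra_simps smult_assoc1 intro!: M.finsum_cong')
    also have "\<dots> = c \<odot>\<^bsub>M\<^esub> lin_ext R M f \<phi>"
      unfolding lin_ext_def using c v\<phi> fin by (subst finsum_smult) auto
    finally show "lin_ext R M f (c \<odot>\<^bsub>?F\<^esub> \<phi>) = c \<odot>\<^bsub>M\<^esub> lin_ext R M f \<phi>" .
  }
  fix \<psi> assume \<psi>: "\<psi> \<in> carrier ?F"
  note v\<psi> = R.monoid_algebra_val[OF \<psi>]
  note s\<psi> = \<psi>[unfolded monoid_algebra_carrier_iff]
  let ?S = "{x. \<phi> x \<noteq> \<zero>} \<union> {x. \<psi> x \<noteq> \<zero>}"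
  have finS: "x \<in> ?S \<Longrightarrow> f x \<in> carrier M" for x
    using s\<phi> s\<psi> f by auto
  have S: "finite ?S" "?S \<subseteq> carrier G"
    using s\<phi> s\<psi> by auto
  have "lin_ext R M f (\<phi> \<oplus>\<^bsub>?F\<^esub> \<psi>) = (\<Oplus>\<^bsub>M\<^esub>x\<in>?S. \<phi> x \<odot>\<^bsub>M\<^esub> f x \<oplus>\<^bsub>M\<^esub> \<psi> x \<odot>\<^bsub>M\<^esub> f x)"
    using S v\<phi> v\<psi> finS F.a_closed[OF \<phi> \<psi>]
    by (subst lin_ext_superset[OF _ f S(1) _ S(2)])
      (auto simp: monoid_algebra_simps smult_l_distr simp del: M.finsum_addf intro!: M.finsum_cong')
  also have "\<dots> = (\<Oplus>\<^bsub>M\<^esub>x\<in>?S. \<phi> x \<odot>\<^bsub>M\<^esub> f x) \<oplus>\<^bsub>M\<^esub> (\<Oplus>\<^bsub>M\<^esub>x\<in>?S. \<psi> x \<odot>\<^bsub>M\<^esub> f x)"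
    using v\<phi> v\<psi> finS by (intro M.finsum_addf) auto
  also have "\<dots> = lin_ext R M f \<phi> \<oplus>\<^bsub>M\<^esub> lin_ext R M f \<psi>"
    using lin_ext_superset[OF \<phi> f S(1) _ S(2)] lin_ext_superset[OF \<psi> f S(1) _ S(2)] by auto
  finally show "lin_ext R M f (\<phi> \<oplus>\<^bsub>?F\<^esub> \<psi>) = lin_ext R M f \<phi> \<oplus>\<^bsub>M\<^esub> lin_ext R M f \<psi>" .
qed

lemma (in module) lin_ext_basis:
  fixes G :: "('g, 'n) monoid_scheme"
  assumes "f \<in> carrier G \<rightarrow> carrier M" "g \<in> carrier G"
  shows "lin_ext R M f (monoid_basis R g) = f g"
proof -
  have "lin_ext R M f (monoid_basis R g) = (\<Oplus>\<^bsub>M\<^esub>x\<in>{g}. monoid_basis R g x \<odot>\<^bsub>M\<^esub> f x)"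
    using assms by (intro lin_ext_superset[OF R.monoid_basis_in[OF assms(2)]])
      (auto simp: monoid_basis_def)
  also have "\<dots> = f g"
    using assms by (auto simp: monoid_basis_def Pi_def)
  finally show ?thesis .
qed

lemma (in mod_hom) hom_finsum:
  assumes "finite A" "g \<in> A \<rightarrow> carrier M"
  shows "f (finsum M g A) = (\<Oplus>\<^bsub>N\<^esub>a\<in>A. f (g a))"
  using assms
proof (induction A rule: finite_induct)
  case (insert x A)
  then have "(\<lambda>a. f (g a)) \<in> insert x A \<rightarrow> carrier N"
    by auto
  with insert show ?case
    by (auto simp: M.M.finsum_insert N.M.finsum_insert)
qed simp

lemma (in module) hom_lin_ext:
  assumes N: "module R N" and h: "h \<in> module_hom R M N" and f: "f \<in> carrier G \<rightarrow> carrier M"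
    and \<phi>: "\<phi> \<in> carrier (monoid_algebra R G)"
  shows "h (lin_ext R M f \<phi>) = lin_ext R N (\<lambda>x. h (f x)) \<phi>"
proof -
  interpret N: module R N by fact
  interpret mod_hom R M N h
    using h by (intro mod_homI) unfold_locales
  have *: "\<phi> x \<odot>\<^bsub>M\<^esub> f x \<in> carrier M \<and> f x \<in> carrier M" if "\<phi> x \<noteq> \<zero>" for x
    using R.monoid_algebra_val[OF \<phi>] monoid_algebra_supp[OF \<phi> that] f by auto
  have "h (lin_ext R M f \<phi>) = (\<Oplus>\<^bsub>N\<^esub>x\<in>{x. \<phi> x \<noteq> \<zero>}. h (\<phi> x \<odot>\<^bsub>M\<^esub> f x))"
    unfolding lin_ext_def using * \<phi> by (intro hom_finsum) (auto simp: monoid_algebra_carrier_iff)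
  also have "\<dots> = lin_ext R N (\<lambda>x. h (f x)) \<phi>"
    unfolding lin_ext_def using * R.monoid_algebra_val[OF \<phi>]
    by (intro N.finsum_cong') auto
  finally show ?thesis .
qed

text \<open>The expansion of a function in the standard basis. Through it
  \<open>hom_free_eqI\<close> reduces an equality of linear maps on a free module to basis
  vectors.\<close>

lemma (in cring) lin_ext_monoid_basis:
  assumes \<phi>: "\<phi> \<in> carrier (monoid_algebra R G)"
  shows "lin_ext R (monoid_algebra R G) (monoid_basis R) \<phi> = \<phi>"
proof
  let ?F = "monoid_algebra R G"
  interpret F: module R ?F by (rule module_monoid_algebra)
  have S: "finite {x. \<phi> x \<noteq> \<zero>}" "{x. \<phi> x \<noteq> \<zero>} \<subseteq> carrier G"
    using \<phi> by (auto simp: monoid_algebra_carrier_iff)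
  note v = monoid_algebra_val[OF \<phi>]
  fix y
  \<comment> \<open>Stated at a point and for arbitrary finite \<open>T\<close>, so that induction
    can split off one basis vector. With \<open>T\<close> the support, the right-hand side is
    \<open>\<phi> y\<close> for every \<open>y\<close>.\<close>
  have "finite T \<Longrightarrow> T \<subseteq> carrier G \<Longrightarrow>
    (\<Oplus>\<^bsub>?F\<^esub>x\<in>T. \<phi> x \<odot>\<^bsub>?F\<^esub> monoid_basis R x) y = (if y \<in> T then \<phi> y else \<zero>)" for T
  proof (induction T rule: finite_induct)
    case empty
    then show ?case by (simp add: monoid_algebra_simps)
  next
    case (insert x T)
    then have "(\<lambda>x. \<phi> x \<odot>\<^bsub>?F\<^esub> monoid_basis R x) \<in> insert x T \<rightarrow> carrier ?F"
      using v by (auto intro!: F.smult_closed monoid_basis_in)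
    with insert show ?case
      using v by (auto simp: F.finsum_insert) (auto simp: monoid_algebra_simps monoid_basis_def)
  qed
  from this[OF S] show "lin_ext R ?F (monoid_basis R) \<phi> y = \<phi> y"
    by (auto simp: lin_ext_def)
qed

lemma (in module) hom_free_eq_lin_ext:
  assumes h: "h \<in> module_hom R (monoid_algebra R G) M"
    and \<phi>: "\<phi> \<in> carrier (monoid_algebra R G)"
  shows "h \<phi> = lin_ext R M (\<lambda>x. h (monoid_basis R x)) \<phi>"
proof -
  interpret F: module R "monoid_algebra R G" by (rule R.module_monoid_algebra)
  have "h \<phi> = h (lin_ext R (monoid_algebra R G) (monoid_basis R) \<phi>)"
    using \<phi> by (simp add: R.lin_ext_monoid_basis)
  also have "\<dots> = lin_ext R M (\<lambda>x. h (monoid_basis R x)) \<phi>"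
    using R.monoid_basis_in by (intro F.hom_lin_ext[OF module_axioms h _ \<phi>]) auto
  finally show ?thesis .
qed

lemma (in module) lin_ext_cong:
  assumes \<phi>: "\<phi> \<in> carrier (monoid_algebra R G)" and g: "g \<in> carrier G \<rightarrow> carrier M"
    and eq: "\<And>x. x \<in> carrier G \<Longrightarrow> f x = g x"
  shows "lin_ext R M f \<phi> = lin_ext R M g \<phi>"
  unfolding lin_ext_def
  using g eq R.monoid_algebra_val[OF \<phi>] monoid_algebra_supp[OF \<phi>]
  by (intro M.finsum_cong') (auto simp: Pi_iff)

lemma (in module) hom_free_eqI:
  assumes h: "h \<in> module_hom R (monoid_algebra R G) M" "k \<in> module_hom R (monoid_algebra R G) M"
    and eq: "\<And>x. x \<in> carrier G \<Longrightarrow> h (monoid_basis R x) = k (monoid_basis R x)"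
    and \<phi>: "\<phi> \<in> carrier (monoid_algebra R G)"
  shows "h \<phi> = k \<phi>"
  unfolding hom_free_eq_lin_ext[OF h(1) \<phi>] hom_free_eq_lin_ext[OF h(2) \<phi>]
  using module_hom_in[OF h(2) R.monoid_basis_in] eq by (intro lin_ext_cong[OF \<phi>]) auto

text \<open>Here the coefficients are fixed and the values vary. This yields linearity of a
  convolution in its second factor, which sits inside the outer sum of
  \<open>monoid_algebra_mult\<close>.\<close>

lemma (in module) lin_ext_hom_parameter:
  assumes "\<And>x. x \<in> carrier G \<Longrightarrow> f x \<in> module_hom R N M" "module R N"
    and \<phi>: "\<phi> \<in> carrier (monoid_algebra R G)"
  shows "(\<lambda>y. lin_ext R M (\<lambda>x. f x y) \<phi>) \<in> module_hom R N M"
proof (rule module_homI)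
  interpret N: module R N by fact
  have *: "\<phi> x \<in> carrier R \<and> f x \<in> module_hom R N M" if "\<phi> x \<noteq> \<zero>" for x
    using R.monoid_algebra_val[OF \<phi>] monoid_algebra_supp[OF \<phi> that] assms(1) by auto
  then have cl: "\<phi> x \<in> carrier R \<and> f x y \<in> carrier M"
    if "\<phi> x \<noteq> \<zero>" "y \<in> carrier N" for x y
    using that by (auto intro: module_hom_in)
  fix y assume y: "y \<in> carrier N"
  show "lin_ext R M (\<lambda>x. f x y) \<phi> \<in> carrier M"
    unfolding lin_ext_def using cl[OF _ y] by (auto intro!: M.finsum_closed)
  {
    fix z assume z: "z \<in> carrier N"
    show "lin_ext R M (\<lambda>x. f x (y \<oplus>\<^bsub>N\<^esub> z)) \<phi> =
        lin_ext R M (\<lambda>x. f x y) \<phi> \<oplus>\<^bsub>M\<^esub> lin_ext R M (\<lambda>x. f x z) \<phi>"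
    proof -
      have "\<phi> x \<odot>\<^bsub>M\<^esub> f x (y \<oplus>\<^bsub>N\<^esub> z) = \<phi> x \<odot>\<^bsub>M\<^esub> f x y \<oplus>\<^bsub>M\<^esub> \<phi> x \<odot>\<^bsub>M\<^esub> f x z" if "\<phi> x \<noteq> \<zero>" for x
        using *[OF that] cl[OF that y] cl[OF that z]
        by (simp add: module_hom_add[OF _ y z] smult_r_distr)
      then show ?thesis
        unfolding lin_ext_def using cl[OF _ y] cl[OF _ z]
        by (subst M.finsum_addf[symmetric])
          (auto intro!: M.finsum_cong' simp del: M.finsum_addf)
    qed
  }
  fix c assume c: "c \<in> carrier R"
  \<comment> \<open>Commutativity of the scalars lets \<open>c\<close> move past the coefficients
    \<open>\<phi> x\<close>.\<close>
  have com: "a \<odot>\<^bsub>M\<^esub> (c \<odot>\<^bsub>M\<^esub> m) = c \<odot>\<^bsub>M\<^esub> (a \<odot>\<^bsub>M\<^esub> m)" if "a \<in> carrier R" "m \<in> carrier M" for a m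
    using that c by (simp add: smult_assoc1[symmetric] R.m_comm)
  show "lin_ext R M (\<lambda>x. f x (c \<odot>\<^bsub>N\<^esub> y)) \<phi> = c \<odot>\<^bsub>M\<^esub> lin_ext R M (\<lambda>x. f x y) \<phi>"
  proof -
    have "\<phi> x \<odot>\<^bsub>M\<^esub> f x (c \<odot>\<^bsub>N\<^esub> y) = c \<odot>\<^bsub>M\<^esub> (\<phi> x \<odot>\<^bsub>M\<^esub> f x y)" if "\<phi> x \<noteq> \<zero>" for x
      using *[OF that] cl[OF that y] by (simp add: module_hom_smult[OF _ c y] com)
    then show ?thesis
      unfolding lin_ext_def using cl[OF _ y] c
      by (subst finsum_smult) (auto intro!: M.finsum_cong')
  qed
qed

section \<open>Tensor products\<close>

text \<open>The record formed by \<open>tensor\<close>, for an arbitrary module and subset. The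
  fields \<open>mult\<close> and \<open>one\<close> are copied from \<open>Quot\<close> so that
  \<open>tensor_quot\<close> is an equality of whole records and also carries the ring
  operations.\<close>

definition quot_module :: "('a, 'b, 'm) module_scheme \<Rightarrow> 'b set \<Rightarrow> ('a, 'b set) module" where
  "quot_module M N = \<lparr>carrier = carrier (M Quot N), mult = mult (M Quot N), one = \<one>\<^bsub>M Quot N\<^esub>,
       zero = \<zero>\<^bsub>M Quot N\<^esub>, add = add (M Quot N),
       smult = (\<lambda>c X. \<Union>x\<in>X. N +>\<^bsub>M\<^esub> (c \<odot>\<^bsub>M\<^esub> x))\<rparr>"

section \<open>Quotients of a module by a submodule\<close>

context module
begin

lemma submodule_abelian_subgroup:
  assumes "LinearCombinations.submodule R N M"
  shows "abelian_subgroup N M"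
proof -
  interpret N: LinearCombinations.submodule R N M by fact
  have "subgroup N (add_monoid M)"
  proof (rule M.add.subgroupI)
    show "N \<noteq> {}" using N.zero_closed by (auto simp del: N.zero_closed)
    fix a assume a: "a \<in> N"
    \<comment> \<open>Negatives come from scaling by minus one, since the submodule axioms speak of
      zero, sums and multiples.\<close>
    then have "(\<ominus> \<one>) \<odot>\<^bsub>M\<^esub> a \<in> N"
      by (intro N.smult_closed) auto
    then show "\<ominus>\<^bsub>M\<^esub> a \<in> N"
      using smult_minus_1[OF subsetD[OF N.subset a]] by simp
  qed (use N.subset N.m_closed in auto)
  then show ?thesis
    by (intro abelian_subgroupI3 additive_subgroup.intro M.abelian_group_axioms)
qed

text \<open>The scalar multiple is a union over all representatives, but the cosets in this union
  coincide: replacing \<open>x\<close> by \<open>n \<oplus> x\<close> changes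
  \<open>c \<odot> x\<close> by \<open>c \<odot> n\<close>, which lies in \<open>N\<close>.\<close>

lemma quot_smult:
  assumes N: "LinearCombinations.submodule R N M" and c: "c \<in> carrier R" and x: "x \<in> carrier M"
  shows "c \<odot>\<^bsub>quot_module M N\<^esub> (N +>\<^bsub>M\<^esub> x) = N +>\<^bsub>M\<^esub> (c \<odot>\<^bsub>M\<^esub> x)"
proof -
  interpret N: LinearCombinations.submodule R N M by fact
  interpret A: abelian_subgroup N M by (rule submodule_abelian_subgroup[OF N])
  have "N +>\<^bsub>M\<^esub> (c \<odot>\<^bsub>M\<^esub> y) = N +>\<^bsub>M\<^esub> (c \<odot>\<^bsub>M\<^esub> x)" if "y \<in> N +>\<^bsub>M\<^esub> x" for y
  proof -
    obtain n where n: "n \<in> N" "y = n \<oplus>\<^bsub>M\<^esub> x"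
      using \<open>y \<in> N +>\<^bsub>M\<^esub> x\<close> by (auto simp: a_r_coset_def')
    then have "c \<odot>\<^bsub>M\<^esub> y \<in> N +>\<^bsub>M\<^esub> (c \<odot>\<^bsub>M\<^esub> x)"
      using N.smult_closed[OF c n(1)] smult_r_distr[OF c subsetD[OF N.subset n(1)] x]
      unfolding a_r_coset_def' by blast
    then show ?thesis
      using A.a_repr_independence'[OF _ smult_closed[OF c x]] by simp
  qed
  then have "(\<Union>y\<in>N +>\<^bsub>M\<^esub> x. N +>\<^bsub>M\<^esub> (c \<odot>\<^bsub>M\<^esub> y)) = (\<Union>y\<in>N +>\<^bsub>M\<^esub> x. N +>\<^bsub>M\<^esub> (c \<odot>\<^bsub>M\<^esub> x))"
    by (rule SUP_cong[OF refl])
  moreover have "x \<in> N +>\<^bsub>M\<^esub> x"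
    using x by (rule A.a_rcos_self)
  ultimately show ?thesis
    by (auto simp: quot_module_def)
qed

lemma quot_carrier:
  "carrier (quot_module M N) = (\<lambda>x. N +>\<^bsub>M\<^esub> x) ` carrier M"
  by (auto simp: quot_module_def FactRing_def A_RCOSETS_def')

lemma quot_add:
  assumes N: "LinearCombinations.submodule R N M" and "x \<in> carrier M" "y \<in> carrier M"
  shows "(N +>\<^bsub>M\<^esub> x) \<oplus>\<^bsub>quot_module M N\<^esub> (N +>\<^bsub>M\<^esub> y) = N +>\<^bsub>M\<^esub> (x \<oplus>\<^bsub>M\<^esub> y)"
  using abelian_subgroup.a_rcos_sum[OF submodule_abelian_subgroup[OF N]] assms(2,3)
  by (simp add: quot_module_def FactRing_def)

lemma module_quot:
  assumes N: "LinearCombinations.submodule R N M"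
  shows "module R (quot_module M N)"
proof -
  interpret A: abelian_subgroup N M by (rule submodule_abelian_subgroup[OF N])
  have zero: "\<zero>\<^bsub>quot_module M N\<^esub> = N +>\<^bsub>M\<^esub> \<zero>\<^bsub>M\<^esub>"
    by (simp add: quot_module_def FactRing_def M.a_coset_add_zero A.a_subset)
  have rep: thesis if "X \<in> carrier (quot_module M N)"
      "\<And>x. \<lbrakk>x \<in> carrier M; X = N +>\<^bsub>M\<^esub> x\<rbrakk> \<Longrightarrow> thesis" for X thesis
    using that by (auto simp: quot_carrier)
  have cl: "x \<in> carrier M \<Longrightarrow> N +>\<^bsub>M\<^esub> x \<in> carrier (quot_module M N)" for x
    by (auto simp: quot_carrier)
  have "abelian_group (quot_module M N)"
  proof (rule abelian_groupI)
    fix X assume "X \<in> carrier (quot_module M N)"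
    then obtain x where x: "x \<in> carrier M" "X = N +>\<^bsub>M\<^esub> x"
      by (auto simp: quot_carrier)
    then have "(N +>\<^bsub>M\<^esub> (\<ominus>\<^bsub>M\<^esub> x)) \<oplus>\<^bsub>quot_module M N\<^esub> X = \<zero>\<^bsub>quot_module M N\<^esub>"
      by (simp add: quot_add[OF N] zero M.l_neg)
    then show "\<exists>Y\<in>carrier (quot_module M N). Y \<oplus>\<^bsub>quot_module M N\<^esub> X = \<zero>\<^bsub>quot_module M N\<^esub>"
      using x by (auto simp: quot_carrier)
  next
    fix X Y assume "X \<in> carrier (quot_module M N)" "Y \<in> carrier (quot_module M N)"
    then show "X \<oplus>\<^bsub>quot_module M N\<^esub> Y = Y \<oplus>\<^bsub>quot_module M N\<^esub> X"
      by (elim rep) (simp add: quot_add[OF N] M.a_comm)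
  next
    fix X Y Z assume "X \<in> carrier (quot_module M N)" "Y \<in> carrier (quot_module M N)"
      "Z \<in> carrier (quot_module M N)"
    then show "(X \<oplus>\<^bsub>quot_module M N\<^esub> Y) \<oplus>\<^bsub>quot_module M N\<^esub> Z =
        X \<oplus>\<^bsub>quot_module M N\<^esub> (Y \<oplus>\<^bsub>quot_module M N\<^esub> Z)"
      by (elim rep) (simp add: quot_add[OF N] M.a_assoc)
  qed (auto elim!: rep simp: quot_add[OF N] zero cl)
  then show ?thesis
    by (intro moduleI R.cring_axioms)
      (auto elim!: rep simp: quot_smult[OF N] quot_add[OF N] smult_l_distr smult_r_distr
        smult_assoc1 cl)
qed

lemma quot_hom:
  assumes N: "LinearCombinations.submodule R N M"
  shows "(\<lambda>x. N +>\<^bsub>M\<^esub> x) \<in> module_hom R M (quot_module M N)"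
  by (rule module_homI) (auto simp: quot_carrier quot_smult[OF N] quot_add[OF N])

lemma quot_zero: "\<zero>\<^bsub>quot_module M N\<^esub> = N"
  by (simp add: quot_module_def FactRing_def)

end

section \<open>Bilinear maps and the universal property of the tensor product\<close>

definition bilinear ::
  "('a, 'r) ring_scheme \<Rightarrow> ('a, 'b, 'm) module_scheme \<Rightarrow> ('a, 'c, 'n) module_scheme
    \<Rightarrow> ('a, 'd, 'p) module_scheme \<Rightarrow> ('b \<Rightarrow> 'c \<Rightarrow> 'd) \<Rightarrow> bool" where
  "bilinear K A B M \<beta> \<longleftrightarrow> (\<forall>a\<in>carrier A. \<beta> a \<in> module_hom K B M) \<and>
     (\<forall>b\<in>carrier B. (\<lambda>a. \<beta> a b) \<in> module_hom K A M)"

lemma bilinearD: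
  assumes "bilinear K A B M \<beta>"
  shows "\<lbrakk>a \<in> carrier A; b \<in> carrier B\<rbrakk> \<Longrightarrow> \<beta> a b \<in> carrier M"
    "\<lbrakk>a \<in> carrier A; a' \<in> carrier A; b \<in> carrier B\<rbrakk> \<Longrightarrow> \<beta> (a \<oplus>\<^bsub>A\<^esub> a') b = \<beta> a b \<oplus>\<^bsub>M\<^esub> \<beta> a' b"
    "\<lbrakk>a \<in> carrier A; b \<in> carrier B; b' \<in> carrier B\<rbrakk> \<Longrightarrow> \<beta> a (b \<oplus>\<^bsub>B\<^esub> b') = \<beta> a b \<oplus>\<^bsub>M\<^esub> \<beta> a b'"
    "\<lbrakk>c \<in> carrier K; a \<in> carrier A; b \<in> carrier B\<rbrakk> \<Longrightarrow> \<beta> (c \<odot>\<^bsub>A\<^esub> a) b = c \<odot>\<^bsub>M\<^esub> \<beta> a b"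
    "\<lbrakk>c \<in> carrier K; a \<in> carrier A; b \<in> carrier B\<rbrakk> \<Longrightarrow> \<beta> a (c \<odot>\<^bsub>B\<^esub> b) = c \<odot>\<^bsub>M\<^esub> \<beta> a b"
  using assms by (simp_all add: bilinear_def module_hom_def Pi_iff)

text \<open>Discharges the hypothesis under which \<open>tensor_lift\<close> is well defined: the
  bilinear maps below arise, up to swapping arguments, from scalar multiplication, the products of
  \<open>K\<close> and \<open>H\<close>, or pure tensors by composition with linear maps.\<close>

lemma bilinear_comp:
  assumes \<beta>: "bilinear K A B M \<beta>"
    and "f \<in> module_hom K A' A" "g \<in> module_hom K B' B" "h \<in> module_hom K M M'"
  shows "bilinear K A' B' M' (\<lambda>a b. h (\<beta> (f a) (g b)))"
  unfolding bilinear_def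
  by (intro conjI ballI module_homI)
    (simp_all add: module_hom_in[OF assms(2)] module_hom_in[OF assms(3)] module_hom_in[OF assms(4)]
      module_hom_add[OF assms(2)] module_hom_add[OF assms(3)] module_hom_add[OF assms(4)]
      module_hom_smult[OF assms(2)] module_hom_smult[OF assms(3)] module_hom_smult[OF assms(4)]
      bilinearD[OF \<beta>])

text \<open>Stated for two arbitrary modules so that one theory serves both the tensor square of
  \<open>H\<close> and that of the group algebra.\<close>

locale two_modules = A: module K A + B: module K B
  for K :: "('a, 'r) ring_scheme" and A :: "('a, 'b, 'm) module_scheme"
    and B :: "('a, 'c, 'n) module_scheme"
begin

abbreviation "F \<equiv> free_prod K A B"
abbreviation "N \<equiv> tensor_null K A B"
abbreviation "T \<equiv> tensor K A B"
abbreviation "pure \<equiv> pure_tensor K A B"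
abbreviation proj where "proj \<phi> \<equiv> N +>\<^bsub>F\<^esub> \<phi>"

lemma module_free: "module K F"
  by (rule A.R.module_monoid_algebra)

sublocale F: module K F
  by (rule module_free)

lemma basis_in: "\<lbrakk>a \<in> carrier A; b \<in> carrier B\<rbrakk> \<Longrightarrow> monoid_basis K (a, b) \<in> carrier F"
  by (intro A.R.monoid_basis_in) simp

lemma rels_closed: "bilin_rels K A B \<subseteq> carrier F"
  by (auto simp: bilin_rels_def Let_def intro!: F.M.minus_closed F.M.a_closed F.smult_closed basis_in)

lemma submodule_null: "LinearCombinations.submodule K N F"
  unfolding tensor_null_def by (rule F.span_is_submodule[OF rels_closed])

lemma null_closed: "n \<in> N \<Longrightarrow> n \<in> carrier F"
  using submodule_null by (auto simp: submodule_def)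

lemma tensor_quot: "T = quot_module F N"
  by (simp add: tensor_def quot_module_def Let_def)

lemma module_tensor: "module K T"
  unfolding tensor_quot by (rule F.module_quot[OF submodule_null])

sublocale T: module K T
  by (rule module_tensor)

lemma proj_hom: "proj \<in> module_hom K F T"
  unfolding tensor_quot by (rule F.quot_hom[OF submodule_null])

sublocale proj: mod_hom K F T proj
  by (intro mod_homI module_free module_tensor proj_hom)

lemma tensorE:
  assumes "X \<in> carrier T"
  obtains \<phi> where "\<phi> \<in> carrier F" "X = proj \<phi>"
  using assms by (auto simp: tensor_quot F.quot_carrier)

lemma proj_null: "n \<in> N \<Longrightarrow> proj n = \<zero>\<^bsub>T\<^esub>"
proof -
  assume "n \<in> N"
  interpret N: abelian_subgroup N F
    by (rule F.submodule_abelian_subgroup[OF submodule_null])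
  from \<open>n \<in> N\<close> show ?thesis
    by (simp add: tensor_quot F.quot_zero N.a_rcos_const)
qed

lemma in_proj:
  assumes \<phi>: "\<phi> \<in> carrier F"
  shows "\<psi> \<in> proj \<phi> \<longleftrightarrow> \<psi> \<in> carrier F \<and> proj \<psi> = proj \<phi>"
proof -
  interpret N: abelian_subgroup N F
    by (rule F.submodule_abelian_subgroup[OF submodule_null])
  show ?thesis
    using N.a_elemrcos_carrier[OF \<phi>, of \<psi>] N.a_repr_independence'[OF _ \<phi>, of \<psi>]
      N.a_rcos_self[of \<psi>] by auto
qed

lemma pure_eq_proj: "pure a b = proj (monoid_basis K (a, b))"
  by (simp add: pure_tensor_def)

lemma bilin_relsI:
  "\<lbrakk>a \<in> carrier A; a' \<in> carrier A; b \<in> carrier B\<rbrakk> \<Longrightarrow> monoid_basis K (a \<oplus>\<^bsub>A\<^esub> a', b) \<ominus>\<^bsub>F\<^esub>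
     (monoid_basis K (a, b) \<oplus>\<^bsub>F\<^esub> monoid_basis K (a', b)) \<in> bilin_rels K A B"
  "\<lbrakk>a \<in> carrier A; b \<in> carrier B; b' \<in> carrier B\<rbrakk> \<Longrightarrow> monoid_basis K (a, b \<oplus>\<^bsub>B\<^esub> b') \<ominus>\<^bsub>F\<^esub>
     (monoid_basis K (a, b) \<oplus>\<^bsub>F\<^esub> monoid_basis K (a, b')) \<in> bilin_rels K A B"
  "\<lbrakk>c \<in> carrier K; a \<in> carrier A; b \<in> carrier B\<rbrakk> \<Longrightarrow> monoid_basis K (c \<odot>\<^bsub>A\<^esub> a, b) \<ominus>\<^bsub>F\<^esub>
     c \<odot>\<^bsub>F\<^esub> monoid_basis K (a, b) \<in> bilin_rels K A B"
  "\<lbrakk>c \<in> carrier K; a \<in> carrier A; b \<in> carrier B\<rbrakk> \<Longrightarrow> monoid_basis K (a, c \<odot>\<^bsub>B\<^esub> b) \<ominus>\<^bsub>F\<^esub>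
     c \<odot>\<^bsub>F\<^esub> monoid_basis K (a, b) \<in> bilin_rels K A B"
  unfolding bilin_rels_def Let_def by blast+

lemma proj_rel:
  assumes "\<phi> \<ominus>\<^bsub>F\<^esub> \<psi> \<in> bilin_rels K A B" "\<phi> \<in> carrier F" "\<psi> \<in> carrier F"
  shows "proj \<phi> = proj \<psi>"
proof -
  have "\<phi> \<ominus>\<^bsub>F\<^esub> \<psi> \<in> N"
    using assms F.in_own_span[OF rels_closed] by (auto simp: tensor_null_def)
  then have "proj \<phi> \<ominus>\<^bsub>T\<^esub> proj \<psi> = \<zero>\<^bsub>T\<^esub>"
    using assms proj_null by (metis proj.f_minus)
  then show ?thesis
    using assms T.M.minus_equality[of "proj \<phi>" "\<ominus>\<^bsub>T\<^esub> proj \<psi>"] by (simp add: a_minus_def)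
qed

text \<open>Once the right-hand side of a bilinearity law is pulled inside a single
  \<open>proj\<close>, the two arguments differ by a generator from one of the four families in
  \<open>bilin_rels\<close>.\<close>

lemma pure_bilinear: "bilinear K A B T pure"
  unfolding bilinear_def pure_eq_proj
proof (intro conjI ballI module_homI)
  note [simp] = basis_in
  fix a b assume ab[simp]: "a \<in> carrier A" "b \<in> carrier B"
  show "proj (monoid_basis K (a, b)) \<in> carrier T"
    by simp
  then show "proj (monoid_basis K (a, b)) \<in> carrier T" .
  {
    fix b' assume [simp]: "b' \<in> carrier B"
    show "proj (monoid_basis K (a, b \<oplus>\<^bsub>B\<^esub> b')) =
      proj (monoid_basis K (a, b)) \<oplus>\<^bsub>T\<^esub> proj (monoid_basis K (a, b'))"
      unfolding proj.f_add[OF basis_in basis_in, OF ab(1) ab(2) ab(1) \<open>b' \<in> carrier B\<close>, symmetric]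
      by (rule proj_rel) (auto intro: bilin_relsI)
  }
  {
    fix a' assume [simp]: "a' \<in> carrier A"
    show "proj (monoid_basis K (a \<oplus>\<^bsub>A\<^esub> a', b)) =
      proj (monoid_basis K (a, b)) \<oplus>\<^bsub>T\<^esub> proj (monoid_basis K (a', b))"
      unfolding proj.f_add[OF basis_in basis_in, OF ab \<open>a' \<in> carrier A\<close> ab(2), symmetric]
      by (rule proj_rel) (auto intro: bilin_relsI)
  }
  fix c assume c[simp]: "c \<in> carrier K"
  show "proj (monoid_basis K (a, c \<odot>\<^bsub>B\<^esub> b)) = c \<odot>\<^bsub>T\<^esub> proj (monoid_basis K (a, b))"
    unfolding proj.f_smult[OF c basis_in, OF ab, symmetric]
    by (rule proj_rel) (auto intro: bilin_relsI)
  show "proj (monoid_basis K (c \<odot>\<^bsub>A\<^esub> a, b)) = c \<odot>\<^bsub>T\<^esub> proj (monoid_basis K (a, b))"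
    unfolding proj.f_smult[OF c basis_in, OF ab, symmetric]
    by (rule proj_rel) (auto intro: bilin_relsI)
qed

lemma pure_closed: "\<lbrakk>a \<in> carrier A; b \<in> carrier B\<rbrakk> \<Longrightarrow> pure a b \<in> carrier T"
  using pure_bilinear by (rule bilinearD)

text \<open>The reason why \<open>tensor_lift\<close> makes sense: bilinearity of
  \<open>\<beta>\<close> puts every relation into the kernel of the linear extension, and this
  kernel is a submodule, so it contains the span of the relations.\<close>

lemma lin_ext_null:
  assumes M: "module K M" and \<beta>: "bilinear K A B M \<beta>" and n: "n \<in> N"
  shows "lin_ext K M (\<lambda>(a, b). \<beta> a b) n = \<zero>\<^bsub>M\<^esub>"
proof -
  interpret M: module K M by fact
  let ?l = "lin_ext K M (\<lambda>(a, b). \<beta> a b)"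
  have \<beta>c: "(\<lambda>(a, b). \<beta> a b) \<in> carrier (A \<times>\<times> B) \<rightarrow> carrier M"
    using bilinearD(1)[OF \<beta>] by auto
  interpret l: mod_hom K F M ?l
    by (intro mod_homI M.lin_ext_hom \<beta>c M module_free)
  have e: "?l (monoid_basis K (a, b)) = \<beta> a b" if "a \<in> carrier A" "b \<in> carrier B" for a b
    using M.lin_ext_basis[OF \<beta>c, of "(a, b)"] that by simp
  have ker: "\<phi> \<ominus>\<^bsub>F\<^esub> \<psi> \<in> l.ker" if "\<phi> \<in> carrier F" "\<psi> \<in> carrier F" "?l \<phi> = ?l \<psi>" for \<phi> \<psi>
    using that by (simp add: l.ker_def M.M.r_neg M.M.minus_eq)
  have "bilin_rels K A B \<subseteq> l.ker"
    unfolding bilin_rels_def Let_def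
    by (intro Un_least subsetI; elim CollectE exE conjE; hypsubst; rule ker)
      (simp_all add: basis_in e bilinearD[OF \<beta>])
  then have "N \<subseteq> l.ker"
    unfolding tensor_null_def by (intro F.span_is_subset l.ker_is_submodule)
  with n show ?thesis
    by (auto simp: l.ker_def)
qed

text \<open>The linear extension is constant on the coset by \<open>lin_ext_null\<close>, so the
  image in \<open>tensor_lift\<close> is a singleton and \<open>the_elem\<close> returns its
  member.\<close>

lemma tensor_lift_proj:
  assumes M: "module K M" and \<beta>: "bilinear K A B M \<beta>" and \<phi>: "\<phi> \<in> carrier F"
  shows "tensor_lift K M \<beta> (proj \<phi>) = lin_ext K M (\<lambda>(a, b). \<beta> a b) \<phi>"
proof -
  interpret M: module K M by fact
  let ?l = "lin_ext K M (\<lambda>(a, b). \<beta> a b)"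
  have "(\<lambda>(a, b). \<beta> a b) \<in> carrier (A \<times>\<times> B) \<rightarrow> carrier M"
    using bilinearD(1)[OF \<beta>] by auto
  then interpret l: mod_hom K F M ?l
    by (intro mod_homI M.lin_ext_hom M module_free)
  have "?l \<psi> = ?l \<phi>" if \<psi>: "\<psi> \<in> proj \<phi>" for \<psi>
  proof -
    obtain n where n: "n \<in> N" "\<psi> = n \<oplus>\<^bsub>F\<^esub> \<phi>"
      using \<psi> by (auto simp: a_r_coset_def')
    show ?thesis
      using l.f_add[OF null_closed[OF n(1)] \<phi>] lin_ext_null[OF M \<beta> n(1)] l.f_im[OF \<phi>] n(2)
      by simp
  qed
  moreover have "\<phi> \<in> proj \<phi>"
    using \<phi> by (simp add: in_proj)
  ultimately have "?l ` proj \<phi> = {?l \<phi>}"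
    by blast
  then show ?thesis
    by (simp add: tensor_lift_def)
qed

lemma tensor_lift_pure:
  assumes M: "module K M" and \<beta>: "bilinear K A B M \<beta>" and ab: "a \<in> carrier A" "b \<in> carrier B"
  shows "tensor_lift K M \<beta> (pure a b) = \<beta> a b"
proof -
  interpret M: module K M by fact
  have "(\<lambda>(a, b). \<beta> a b) \<in> carrier (A \<times>\<times> B) \<rightarrow> carrier M"
    using bilinearD(1)[OF \<beta>] by auto
  from M.lin_ext_basis[OF this, of "(a, b)"] ab show ?thesis
    by (simp add: pure_eq_proj tensor_lift_proj[OF M \<beta>] basis_in)
qed

lemma tensor_lift_hom:
  assumes M: "module K M" and \<beta>: "bilinear K A B M \<beta>"
  shows "tensor_lift K M \<beta> \<in> module_hom K T M"
proof -
  interpret M: module K M by fact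
  let ?l = "lin_ext K M (\<lambda>(a, b). \<beta> a b)"
  have "(\<lambda>(a, b). \<beta> a b) \<in> carrier (A \<times>\<times> B) \<rightarrow> carrier M"
    using bilinearD(1)[OF \<beta>] by auto
  then interpret l: mod_hom K F M ?l
    by (intro mod_homI M.lin_ext_hom M module_free)
  note lift = tensor_lift_proj[OF M \<beta>]
  show ?thesis
  proof (rule module_homI)
    fix X assume "X \<in> carrier T"
    then obtain \<phi> where \<phi>: "\<phi> \<in> carrier F" "X = proj \<phi>" by (rule tensorE)
    show "tensor_lift K M \<beta> X \<in> carrier M"
      using l.f_im[OF \<phi>(1)] lift[OF \<phi>(1)] \<phi>(2) by simp
    show "tensor_lift K M \<beta> (c \<odot>\<^bsub>T\<^esub> X) = c \<odot>\<^bsub>M\<^esub> tensor_lift K M \<beta> X" if "c \<in> carrier K" for c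
      unfolding \<phi>(2) proj.f_smult[OF that \<phi>(1), symmetric]
      using lift[OF \<phi>(1)] lift[OF F.smult_closed[OF that \<phi>(1)]] l.f_smult[OF that \<phi>(1)] by argo
    fix Y assume "Y \<in> carrier T"
    then obtain \<psi> where \<psi>: "\<psi> \<in> carrier F" "Y = proj \<psi>" by (rule tensorE)
    show "tensor_lift K M \<beta> (X \<oplus>\<^bsub>T\<^esub> Y) = tensor_lift K M \<beta> X \<oplus>\<^bsub>M\<^esub> tensor_lift K M \<beta> Y"
      unfolding \<phi>(2) \<psi>(2) proj.f_add[OF \<phi>(1) \<psi>(1), symmetric]
      using lift[OF \<phi>(1)] lift[OF \<psi>(1)] lift[OF F.M.a_closed[OF \<phi>(1) \<psi>(1)]]
        l.f_add[OF \<phi>(1) \<psi>(1)] by argo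
  qed
qed

end

section \<open>Multiplication on tensor products\<close>

lemma module_hom_cong:
  assumes "module R M" "f \<in> module_hom R M N" "\<And>x. x \<in> carrier M \<Longrightarrow> g x = f x"
  shows "g \<in> module_hom R M N"
proof -
  interpret M: module R M by fact
  show ?thesis
    using assms(2,3) by (intro module_homI) (auto simp: module_hom_def)
qed

lemma zero_hom:
  assumes "module R N"
  shows "(\<lambda>x. \<zero>\<^bsub>N\<^esub>) \<in> module_hom R M N"
proof -
  interpret N: module R N by fact
  show ?thesis
    by (rule module_homI) auto
qed

text \<open>One convolution calculus for two index structures: the pairs underlying a tensor
  product, and the group-like elements.\<close>

locale magma_algebra = cring R for R :: "('a, 'r) ring_scheme" (structure) +
  fixes G :: "('g, 'n) monoid_scheme"
  assumes G_closed: "\<lbrakk>x \<in> carrier G; y \<in> carrier G\<rbrakk> \<Longrightarrow> x \<otimes>\<^bsub>G\<^esub> y \<in> carrier G"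
begin

sublocale F: module R "monoid_algebra R G" by (rule module_monoid_algebra)

text \<open>Writes convolution as a nested linear extension, so that its linearity in each factor is
  inherited from \<open>lin_ext\<close>.\<close>

lemma monoid_algebra_mult:
  assumes \<phi>: "\<phi> \<in> carrier (monoid_algebra R G)" and \<psi>: "\<psi> \<in> carrier (monoid_algebra R G)"
  shows "\<phi> \<otimes>\<^bsub>monoid_algebra R G\<^esub> \<psi> =
    lin_ext R (monoid_algebra R G)
      (\<lambda>x. lin_ext R (monoid_algebra R G) (\<lambda>y. monoid_basis R (x \<otimes>\<^bsub>G\<^esub> y)) \<psi>) \<phi>"
proof
  let ?F = "monoid_algebra R G"
  fix z
  \<comment> \<open>Sums of functions are evaluated pointwise; this turns the claim into an equation
    between double sums in the coefficient ring.\<close>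
  have fs: "finsum ?F f T z = (\<Oplus>x\<in>T. f x z)"
    if "finite T" "f \<in> T \<rightarrow> carrier ?F" for T and f :: "'x \<Rightarrow> 'g \<Rightarrow> 'a"
    using that
  proof (induction T rule: finite_induct)
    case empty
    then show ?case by (simp add: monoid_algebra_simps)
  next
    case (insert x T)
    then have "(\<lambda>x. f x z) \<in> insert x T \<rightarrow> carrier R"
      by (intro funcsetI monoid_algebra_val) auto
    with insert show ?case
      by (auto simp: F.finsum_insert) (auto simp: monoid_algebra_simps)
  qed
  have v: "\<phi> x \<in> carrier R" "\<psi> x \<in> carrier R" for x
    using monoid_algebra_val[OF \<phi>] monoid_algebra_val[OF \<psi>] by auto
  have S: "finite {x. \<phi> x \<noteq> \<zero>}" "finite {x. \<psi> x \<noteq> \<zero>}"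
    "\<And>x. \<phi> x \<noteq> \<zero> \<Longrightarrow> x \<in> carrier G" "\<And>x. \<psi> x \<noteq> \<zero> \<Longrightarrow> x \<in> carrier G"
    using \<phi> \<psi> by (auto simp: monoid_algebra_carrier_iff)
  have b: "monoid_basis R (x \<otimes>\<^bsub>G\<^esub> y) \<in> carrier ?F"
    if "x \<in> carrier G" "y \<in> carrier G" for x y
    using that G_closed by (intro monoid_basis_in)
  have L: "lin_ext R ?F (\<lambda>y. monoid_basis R (x \<otimes>\<^bsub>G\<^esub> y)) \<psi> \<in> carrier ?F"
    if "x \<in> carrier G" for x
    using that b by (intro module_hom_in[OF F.lin_ext_hom \<psi>]) auto
  have val: "lin_ext R ?F f \<chi> z = (\<Oplus>x\<in>{x. \<chi> x \<noteq> \<zero>}. \<chi> x \<otimes> f x z)"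
    if "\<chi> \<in> carrier ?F" "f \<in> carrier G \<rightarrow> carrier ?F" for f \<chi>
  proof -
    have "(\<lambda>x. \<chi> x \<odot>\<^bsub>?F\<^esub> f x) \<in> {x. \<chi> x \<noteq> \<zero>} \<rightarrow> carrier ?F" "finite {x. \<chi> x \<noteq> \<zero>}"
      using that monoid_algebra_supp[OF that(1)] monoid_algebra_val[OF that(1)]
      by (auto simp: monoid_algebra_carrier_iff[of \<chi>])
    then show ?thesis
      by (simp add: lin_ext_def fs) (simp add: monoid_algebra_simps)
  qed
  have "lin_ext R ?F (\<lambda>x. lin_ext R ?F (\<lambda>y. monoid_basis R (x \<otimes>\<^bsub>G\<^esub> y)) \<psi>) \<phi> z =
    (\<Oplus>x\<in>{x. \<phi> x \<noteq> \<zero>}. \<phi> x \<otimes> lin_ext R ?F (\<lambda>y. monoid_basis R (x \<otimes>\<^bsub>G\<^esub> y)) \<psi> z)"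
    using L by (intro val[OF \<phi>]) auto
  also have "\<dots> = (\<Oplus>x\<in>{x. \<phi> x \<noteq> \<zero>}. \<Oplus>y\<in>{y. \<psi> y \<noteq> \<zero>}.
       (if x \<otimes>\<^bsub>G\<^esub> y = z then \<phi> x \<otimes> \<psi> y else \<zero>))"
  proof (intro finsum_cong' refl)
    fix x assume "x \<in> {x. \<phi> x \<noteq> \<zero>}"
    then have x: "x \<in> carrier G"
      using S by auto
    have "\<phi> x \<otimes> lin_ext R ?F (\<lambda>y. monoid_basis R (x \<otimes>\<^bsub>G\<^esub> y)) \<psi> z =
      \<phi> x \<otimes> (\<Oplus>y\<in>{y. \<psi> y \<noteq> \<zero>}. \<psi> y \<otimes> monoid_basis R (x \<otimes>\<^bsub>G\<^esub> y) z)"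
      using b[OF x] by (subst val[OF \<psi>]) auto
    also have "\<dots> = (\<Oplus>y\<in>{y. \<psi> y \<noteq> \<zero>}. \<phi> x \<otimes> (\<psi> y \<otimes> monoid_basis R (x \<otimes>\<^bsub>G\<^esub> y) z))"
      using S v by (intro finsum_rdistr) (auto simp: monoid_basis_def)
    also have "\<dots> = (\<Oplus>y\<in>{y. \<psi> y \<noteq> \<zero>}. if x \<otimes>\<^bsub>G\<^esub> y = z then \<phi> x \<otimes> \<psi> y else \<zero>)"
      using v by (intro finsum_cong') (auto simp: monoid_basis_def)
    finally show "\<phi> x \<otimes> lin_ext R ?F (\<lambda>y. monoid_basis R (x \<otimes>\<^bsub>G\<^esub> y)) \<psi> z =
      (\<Oplus>y\<in>{y. \<psi> y \<noteq> \<zero>}. if x \<otimes>\<^bsub>G\<^esub> y = z then \<phi> x \<otimes> \<psi> y else \<zero>)" .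
  qed (use v in \<open>auto intro!: finsum_closed\<close>)
  finally show "(\<phi> \<otimes>\<^bsub>?F\<^esub> \<psi>) z = lin_ext R ?F (\<lambda>x. lin_ext R ?F (\<lambda>y. monoid_basis R (x \<otimes>\<^bsub>G\<^esub> y)) \<psi>) \<phi> z"
    by (simp add: monoid_algebra_def)
qed

lemma mult_hom_basis:
  assumes "x \<in> carrier G"
  shows "lin_ext R (monoid_algebra R G) (\<lambda>y. monoid_basis R (x \<otimes>\<^bsub>G\<^esub> y))
    \<in> module_hom R (monoid_algebra R G) (monoid_algebra R G)"
  using assms G_closed by (intro F.lin_ext_hom) (auto intro: monoid_basis_in)

lemma monoid_algebra_mult_hom_right:
  assumes \<phi>: "\<phi> \<in> carrier (monoid_algebra R G)"
  shows "(\<lambda>\<psi>. \<phi> \<otimes>\<^bsub>monoid_algebra R G\<^esub> \<psi>)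
    \<in> module_hom R (monoid_algebra R G) (monoid_algebra R G)"
  by (rule module_hom_cong[OF F.module_axioms
        F.lin_ext_hom_parameter[OF mult_hom_basis F.module_axioms \<phi>]])
    (simp_all add: monoid_algebra_mult[OF \<phi>])

lemma monoid_algebra_mult_hom_left:
  assumes \<psi>: "\<psi> \<in> carrier (monoid_algebra R G)"
  shows "(\<lambda>\<phi>. \<phi> \<otimes>\<^bsub>monoid_algebra R G\<^esub> \<psi>)
    \<in> module_hom R (monoid_algebra R G) (monoid_algebra R G)"
  by (rule module_hom_cong[OF F.module_axioms F.lin_ext_hom monoid_algebra_mult[OF _ \<psi>]])
    (auto intro: module_hom_in[OF mult_hom_basis \<psi>])

lemma monoid_basis_mult:
  assumes x: "x \<in> carrier G" and y: "y \<in> carrier G"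
  shows "monoid_basis R x \<otimes>\<^bsub>monoid_algebra R G\<^esub> monoid_basis R y = monoid_basis R (x \<otimes>\<^bsub>G\<^esub> y)"
proof -
  let ?F = "monoid_algebra R G"
  have "monoid_basis R x \<otimes>\<^bsub>?F\<^esub> monoid_basis R y =
    lin_ext R ?F (\<lambda>y. monoid_basis R (x \<otimes>\<^bsub>G\<^esub> y)) (monoid_basis R y)"
    using module_hom_in[OF mult_hom_basis monoid_basis_in[OF y]]
    by (simp add: monoid_algebra_mult[OF monoid_basis_in[OF x] monoid_basis_in[OF y]]
        F.lin_ext_basis[OF _ x])
  also have "\<dots> = monoid_basis R (x \<otimes>\<^bsub>G\<^esub> y)"
    by (intro F.lin_ext_basis[OF _ y]) (auto intro!: monoid_basis_in G_closed x)
  finally show ?thesis .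
qed

end

section \<open>The null space as an ideal, and products of pure tensors\<close>

locale two_algebras = two_modules K A B + A': assoc_algebra K A + B': assoc_algebra K B
  for K :: "('a, 'r) ring_scheme" and A :: "('a, 'b, 'm) module_scheme"
    and B :: "('a, 'c, 'n) module_scheme"
begin

sublocale AB: magma_algebra K "A \<times>\<times> B"
  by unfold_locales auto

lemmas free_mult_hom_left = AB.monoid_algebra_mult_hom_left
lemmas free_mult_hom_right = AB.monoid_algebra_mult_hom_right
lemmas free_basis_mult = AB.monoid_basis_mult

text \<open>Half of the ideal property, without multiplying out relations. By linearity
  \<open>\<psi>\<close> may be a basis vector \<open>(a', b')\<close>. Multiplying by it and
  projecting is then the linear extension of the bilinear map
  \<open>a, b \<mapsto> a a' \<otimes> b b'\<close>, and such an extension kills the null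
  space.\<close>

lemma proj_null_mult_left:
  assumes n: "n \<in> N" and \<psi>: "\<psi> \<in> carrier F"
  shows "proj (n \<otimes>\<^bsub>F\<^esub> \<psi>) = \<zero>\<^bsub>T\<^esub>"
proof (rule T.hom_free_eqI[OF module_hom_comp[OF free_mult_hom_right proj_hom] zero_hom _ \<psi>])
  show "n \<in> carrier F" using n by (rule null_closed)
  show "module K T" by (rule module_tensor)
  fix y assume y: "y \<in> carrier (A \<times>\<times> B)"
  then obtain a' b' where ab: "y = (a', b')" "a' \<in> carrier A" "b' \<in> carrier B" by auto
  have ey: "monoid_basis K y \<in> carrier F"
    using ab by (simp add: basis_in)
  have bil: "bilinear K A B T (\<lambda>a b. pure (a \<otimes>\<^bsub>A\<^esub> a') (b \<otimes>\<^bsub>B\<^esub> b'))"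
    using ab by (intro bilinear_comp[OF pure_bilinear _ _ module_hom_id] module_homI)
      (auto simp: A'.A.l_distr B'.A.l_distr A'.smult_mult_left B'.smult_mult_left)
  have "proj (n \<otimes>\<^bsub>F\<^esub> monoid_basis K y) =
      lin_ext K T (\<lambda>x. proj (monoid_basis K x \<otimes>\<^bsub>F\<^esub> monoid_basis K y)) n"
    by (rule T.hom_free_eq_lin_ext[OF module_hom_comp[OF free_mult_hom_left[OF ey] proj_hom]])
      (rule null_closed[OF n])
  also have "\<dots> = lin_ext K T (\<lambda>(a, b). pure (a \<otimes>\<^bsub>A\<^esub> a') (b \<otimes>\<^bsub>B\<^esub> b')) n"
    using bilinearD(1)[OF bil] ab(2,3)
    by (intro T.lin_ext_cong[OF null_closed[OF n]])
      (auto simp: free_basis_mult pure_eq_proj ab(1))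
  also have "\<dots> = \<zero>\<^bsub>T\<^esub>"
    by (rule lin_ext_null[OF module_tensor bil n])
  finally show "proj (n \<otimes>\<^bsub>F\<^esub> monoid_basis K y) = \<zero>\<^bsub>T\<^esub>" .
qed

lemma proj_null_mult_right:
  assumes n: "n \<in> N" and \<psi>: "\<psi> \<in> carrier F"
  shows "proj (\<psi> \<otimes>\<^bsub>F\<^esub> n) = \<zero>\<^bsub>T\<^esub>"
proof (rule T.hom_free_eqI[OF module_hom_comp[OF free_mult_hom_left proj_hom] zero_hom _ \<psi>])
  show "n \<in> carrier F" using n by (rule null_closed)
  show "module K T" by (rule module_tensor)
  fix y assume y: "y \<in> carrier (A \<times>\<times> B)"
  then obtain a' b' where ab: "y = (a', b')" "a' \<in> carrier A" "b' \<in> carrier B" by auto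
  have ey: "monoid_basis K y \<in> carrier F"
    using ab by (simp add: basis_in)
  have bil: "bilinear K A B T (\<lambda>a b. pure (a' \<otimes>\<^bsub>A\<^esub> a) (b' \<otimes>\<^bsub>B\<^esub> b))"
    using ab by (intro bilinear_comp[OF pure_bilinear _ _ module_hom_id] module_homI)
      (auto simp: A'.A.r_distr B'.A.r_distr A'.smult_mult_right B'.smult_mult_right)
  have "proj (monoid_basis K y \<otimes>\<^bsub>F\<^esub> n) =
      lin_ext K T (\<lambda>x. proj (monoid_basis K y \<otimes>\<^bsub>F\<^esub> monoid_basis K x)) n"
    by (rule T.hom_free_eq_lin_ext[OF module_hom_comp[OF free_mult_hom_right[OF ey] proj_hom]])
      (rule null_closed[OF n])
  also have "\<dots> = lin_ext K T (\<lambda>(a, b). pure (a' \<otimes>\<^bsub>A\<^esub> a) (b' \<otimes>\<^bsub>B\<^esub> b)) n"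
    using bilinearD(1)[OF bil] ab(2,3)
    by (intro T.lin_ext_cong[OF null_closed[OF n]])
      (auto simp: free_basis_mult pure_eq_proj ab(1))
  also have "\<dots> = \<zero>\<^bsub>T\<^esub>"
    by (rule lin_ext_null[OF module_tensor bil n])
  finally show "proj (monoid_basis K y \<otimes>\<^bsub>F\<^esub> n) = \<zero>\<^bsub>T\<^esub>" .
qed

text \<open>The product in \<open>Quot\<close> is a union over pairs of representatives. Changing
  either representative adds a term that the absorption lemmas send to zero, so all cosets in the
  union agree.\<close>

lemma proj_mult:
  assumes \<phi>: "\<phi> \<in> carrier F" and \<psi>: "\<psi> \<in> carrier F"
  shows "proj \<phi> \<otimes>\<^bsub>T\<^esub> proj \<psi> = proj (\<phi> \<otimes>\<^bsub>F\<^esub> \<psi>)"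
proof -
  note cl = module_hom_in[OF free_mult_hom_left]
  have "proj (\<alpha> \<otimes>\<^bsub>F\<^esub> \<beta>) = proj (\<phi> \<otimes>\<^bsub>F\<^esub> \<psi>)" if \<alpha>: "\<alpha> \<in> proj \<phi>" and \<beta>: "\<beta> \<in> proj \<psi>" for \<alpha> \<beta>
  proof -
    obtain n where n: "n \<in> N" "\<alpha> = n \<oplus>\<^bsub>F\<^esub> \<phi>"
      using \<alpha> by (auto simp: a_r_coset_def')
    obtain m where m: "m \<in> N" "\<beta> = m \<oplus>\<^bsub>F\<^esub> \<psi>"
      using \<beta> by (auto simp: a_r_coset_def')
    have c: "n \<in> carrier F" "m \<in> carrier F" "\<beta> \<in> carrier F"
      using n(1) m \<psi> null_closed by auto
    have "proj (\<alpha> \<otimes>\<^bsub>F\<^esub> \<beta>) = proj (n \<otimes>\<^bsub>F\<^esub> \<beta>) \<oplus>\<^bsub>T\<^esub> proj (\<phi> \<otimes>\<^bsub>F\<^esub> \<beta>)"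
      unfolding n(2) module_hom_add[OF free_mult_hom_left[OF c(3)] c(1) \<phi>]
      by (rule proj.f_add[OF cl[OF c(3) c(1)] cl[OF c(3) \<phi>]])
    also have "\<dots> = proj (\<phi> \<otimes>\<^bsub>F\<^esub> \<beta>)"
      using proj_null_mult_left[OF n(1) c(3)] proj.f_im[OF cl[OF c(3) \<phi>]] by simp
    also have "\<dots> = proj (\<phi> \<otimes>\<^bsub>F\<^esub> m) \<oplus>\<^bsub>T\<^esub> proj (\<phi> \<otimes>\<^bsub>F\<^esub> \<psi>)"
      unfolding m(2) module_hom_add[OF free_mult_hom_right[OF \<phi>] c(2) \<psi>]
      by (rule proj.f_add[OF cl[OF c(2) \<phi>] cl[OF \<psi> \<phi>]])
    also have "\<dots> = proj (\<phi> \<otimes>\<^bsub>F\<^esub> \<psi>)"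
      using proj_null_mult_right[OF m(1) \<phi>] proj.f_im[OF cl[OF \<psi> \<phi>]] by simp
    finally show ?thesis .
  qed
  then have "(\<Union>\<alpha>\<in>proj \<phi>. \<Union>\<beta>\<in>proj \<psi>. proj (\<alpha> \<otimes>\<^bsub>F\<^esub> \<beta>)) =
      (\<Union>\<alpha>\<in>proj \<phi>. \<Union>\<beta>\<in>proj \<psi>. proj (\<phi> \<otimes>\<^bsub>F\<^esub> \<psi>))"
    by (intro SUP_cong refl)
  moreover have "\<phi> \<in> proj \<phi>" "\<psi> \<in> proj \<psi>"
    using \<phi> \<psi> by (simp_all add: in_proj)
  ultimately show ?thesis
    by (auto simp: tensor_quot quot_module_def FactRing_def rcoset_mult_def)
qed

lemma pure_mult:
  assumes "a \<in> carrier A" "b \<in> carrier B" "a' \<in> carrier A" "b' \<in> carrier B"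
  shows "pure a b \<otimes>\<^bsub>T\<^esub> pure a' b' = pure (a \<otimes>\<^bsub>A\<^esub> a') (b \<otimes>\<^bsub>B\<^esub> b')"
  using assms by (simp add: pure_eq_proj proj_mult basis_in free_basis_mult)

lemma pure_one: "\<one>\<^bsub>T\<^esub> = pure \<one>\<^bsub>A\<^esub> \<one>\<^bsub>B\<^esub>"
  by (simp add: tensor_quot quot_module_def FactRing_def pure_eq_proj monoid_algebra_simps)

end

section \<open>Coordinates\<close>

lemma (in cring) module_self: "module R (self_module R)"
proof -
  have "abelian_group (self_module R)"
    by (rule abelian_groupI) (auto simp: self_module_def a_ac intro: bexI[of _ "\<ominus> _"] l_neg)
  then show ?thesis
    by (intro moduleI cring_axioms) (auto simp: self_module_def l_distr r_distr m_assoc)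
qed

lemma self_module_simps:
  "carrier (self_module R) = carrier R" "\<zero>\<^bsub>self_module R\<^esub> = \<zero>\<^bsub>R\<^esub>"
  "x \<oplus>\<^bsub>self_module R\<^esub> y = x \<oplus>\<^bsub>R\<^esub> y" "x \<odot>\<^bsub>self_module R\<^esub> y = x \<otimes>\<^bsub>R\<^esub> y"
  by (simp_all add: self_module_def)

lemma (in cring) eval_hom: "(\<lambda>\<phi>. \<phi> x) \<in> module_hom R (monoid_algebra R G) (self_module R)"
  by (rule module_homI) (simp_all add: self_module_simps monoid_algebra_simps monoid_algebra_val)

lemma (in module) smult_bilinear: "bilinear R (self_module R) M M (\<lambda>c x. c \<odot>\<^bsub>M\<^esub> x)"
  unfolding bilinear_def
  by (intro conjI ballI module_homI)
    (simp_all add: self_module_simps smult_l_distr smult_r_distr smult_assoc1[symmetric] R.m_comm)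

lemma (in cring) mult_bilinear:
  "bilinear R (self_module R) (self_module R) (self_module R) (\<lambda>c d. c \<otimes> d)"
  unfolding bilinear_def
  by (intro conjI ballI module_homI)
    (simp_all add: self_module_simps l_distr r_distr m_ac)

lemma bilinear_flip: "bilinear K A B M \<beta> \<Longrightarrow> bilinear K B A M (\<lambda>b a. \<beta> a b)"
  by (simp add: bilinear_def)

section \<open>Bases of modules and coordinates\<close>

lemma bij_module_hom_inverse:
  assumes M: "module R M" and f: "f \<in> module_hom R M N"
    and bij: "bij_betw f (carrier M) (carrier N)"
  shows "inv_into (carrier M) f \<in> module_hom R N M"
proof -
  interpret M: module R M by fact
  let ?g = "inv_into (carrier M) f"
  have g: "?g y \<in> carrier M" "f (?g y) = y" if "y \<in> carrier N" for y
    using bij that by (auto simp: bij_betw_def inv_into_into f_inv_into_f)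
  have eq: "?g y = x" if "x \<in> carrier M" "y = f x" for x y
    using bij that by (simp add: bij_betw_def inv_into_f_f)
  show ?thesis
    by (rule module_homI; (rule eq)?)
      (simp_all add: g module_hom_add[OF f] module_hom_smult[OF f])
qed

text \<open>A basis is encoded as bijectivity of the evaluation map from the free module;
  coordinates are then its inverse and are linear. The index set is the carrier of a monoid record
  because \<open>monoid_algebra\<close> takes one.\<close>

locale module_basis = module R M
  for R :: "('a, 'r) ring_scheme" and M :: "('a, 'c, 'm) module_scheme" +
  fixes G :: "('c, 'n) monoid_scheme"
  assumes basis_closed: "carrier G \<subseteq> carrier M"
    and lin_ext_bij: "bij_betw (lin_ext R M (\<lambda>x. x)) (carrier (monoid_algebra R G)) (carrier M)"
begin

abbreviation comb :: "('c \<Rightarrow> 'a) \<Rightarrow> 'c" where "comb \<equiv> lin_ext R M (\<lambda>x. x)"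

definition coords :: "'c \<Rightarrow> 'c \<Rightarrow> 'a" where
  "coords = inv_into (carrier (monoid_algebra R G)) comb"

lemma basis_in_carrier: "g \<in> carrier G \<Longrightarrow> g \<in> carrier M"
  using basis_closed by auto

lemma comb_hom: "comb \<in> module_hom R (monoid_algebra R G) M"
  using basis_closed by (intro lin_ext_hom) auto

lemma coords_hom: "coords \<in> module_hom R M (monoid_algebra R G)"
  unfolding coords_def
  by (rule bij_module_hom_inverse[OF R.module_monoid_algebra comb_hom lin_ext_bij])

lemma coords_closed: "x \<in> carrier M \<Longrightarrow> coords x \<in> carrier (monoid_algebra R G)"
  by (rule module_hom_in[OF coords_hom])

lemma coord_hom: "(\<lambda>x. coords x g) \<in> module_hom R M (self_module R)"
  by (rule module_hom_comp[OF coords_hom R.eval_hom])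

lemma comb_coords: "x \<in> carrier M \<Longrightarrow> comb (coords x) = x"
  using lin_ext_bij unfolding coords_def by (auto simp: bij_betw_def f_inv_into_f)

lemma coords_comb: "\<phi> \<in> carrier (monoid_algebra R G) \<Longrightarrow> coords (comb \<phi>) = \<phi>"
  using lin_ext_bij unfolding coords_def by (auto simp: bij_betw_def inv_into_f_f)

lemma comb_basis: "g \<in> carrier G \<Longrightarrow> comb (monoid_basis R g) = g"
  using basis_closed by (intro lin_ext_basis) auto

lemma coords_basis: "g \<in> carrier G \<Longrightarrow> coords g = monoid_basis R g"
  using coords_comb[OF R.monoid_basis_in, of g] by (simp add: comb_basis)

lemma bij_coords: "bij_betw coords (carrier M) (carrier (monoid_algebra R G))"
  unfolding coords_def by (rule bij_betw_inv_into[OF lin_ext_bij])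

lemma hom_eq_lin_ext:
  assumes "module R N" "h \<in> module_hom R M N" "x \<in> carrier M"
  shows "h x = lin_ext R N h (coords x)"
  using hom_lin_ext[OF assms(1,2) _ coords_closed[OF assms(3)], of "\<lambda>x. x"] basis_closed
  by (auto simp: comb_coords[OF assms(3)])

text \<open>Used with the basis \<open>B\<close> for the coordinate functionals, and with the basis
  of group-likes for compatibility with comultiplication, counit and antipode.\<close>

lemma hom_eqI:
  assumes N: "module R N" and h: "h \<in> module_hom R M N" and k: "k \<in> module_hom R M N"
    and eq: "\<And>g. g \<in> carrier G \<Longrightarrow> h g = k g" and x: "x \<in> carrier M"
  shows "h x = k x"
proof -
  interpret N: module R N by fact
  show ?thesis
    unfolding hom_eq_lin_ext[OF N h x] hom_eq_lin_ext[OF N k x]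
    using module_hom_in[OF k basis_in_carrier] eq by (intro N.lin_ext_cong[OF coords_closed[OF x]]) auto
qed

end

lemma (in module) module_basisI:
  assumes sub: "carrier G \<subseteq> carrier M"
    and ker: "\<And>\<phi> g. \<lbrakk>\<phi> \<in> carrier (monoid_algebra R G); lin_ext R M (\<lambda>x. x) \<phi> = \<zero>\<^bsub>M\<^esub>;
      g \<in> carrier G\<rbrakk> \<Longrightarrow> \<phi> g = \<zero>"
    and gen: "carrier M \<subseteq> lin_ext R M (\<lambda>x. x) ` carrier (monoid_algebra R G)"
  shows "module_basis R M G"
proof (unfold_locales, rule sub)
  let ?F = "monoid_algebra R G"
  let ?p = "lin_ext R M (\<lambda>x. x)"
  interpret F: module R ?F by (rule R.module_monoid_algebra)
  interpret p: mod_hom R ?F M ?p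
    using sub by (intro mod_homI F.module_axioms module_axioms lin_ext_hom) auto
  have "inj_on ?p (carrier ?F)"
  proof (rule inj_onI)
    fix \<phi> \<psi> assume a: "\<phi> \<in> carrier ?F" "\<psi> \<in> carrier ?F" "?p \<phi> = ?p \<psi>"
    let ?d = "\<phi> \<ominus>\<^bsub>?F\<^esub> \<psi>"
    have d: "?d \<in> carrier ?F"
      using a by (intro F.M.minus_closed)
    moreover have "?p ?d = \<zero>\<^bsub>M\<^esub>"
      using a by (simp add: M.r_neg M.minus_eq)
    \<comment> \<open>Indices outside \<open>carrier G\<close> are covered by the support
      condition.\<close>
    ultimately have "?d g = \<zero>" for g
      using ker[of ?d g] monoid_algebra_supp[OF d] by blast
    then have "?d = \<zero>\<^bsub>?F\<^esub>"
      by (auto simp: monoid_algebra_simps)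
    then show "\<phi> = \<psi>"
      using a F.M.minus_equality[of \<phi> "\<ominus>\<^bsub>?F\<^esub> \<psi>"] by (simp add: F.M.minus_eq)
  qed
  then show "bij_betw ?p (carrier ?F) (carrier M)"
    using gen by (auto simp: bij_betw_def)
qed

text \<open>The image is a submodule, so it is everything once it contains a spanning set. The
  spanning set may differ from the index set: for the group-likes it is the original basis
  \<open>B\<close>.\<close>

lemma (in module) lin_ext_id_surj:
  assumes sub: "carrier G \<subseteq> carrier M" and gen: "span B = carrier M"
    and B: "B \<subseteq> lin_ext R M (\<lambda>x. x) ` carrier (monoid_algebra R G)"
  shows "carrier M \<subseteq> lin_ext R M (\<lambda>x. x) ` carrier (monoid_algebra R G)"
proof -
  interpret p: mod_hom R "monoid_algebra R G" M "lin_ext R M (\<lambda>x. x)"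
    using sub by (intro mod_homI R.module_monoid_algebra module_axioms lin_ext_hom) auto
  show ?thesis
    using span_is_subset[OF _ p.im_is_submodule, of B] B gen by (simp add: p.im_def)
qed

lemma (in module) module_basis_lin_indpt:
  assumes sub: "carrier G \<subseteq> carrier M" and li: "lin_indpt (carrier G)"
    and gen: "span (carrier G) = carrier M"
  shows "module_basis R M G"
proof (rule module_basisI[OF sub _ lin_ext_id_surj[OF sub gen]])
  fix \<phi> g assume \<phi>: "\<phi> \<in> carrier (monoid_algebra R G)" "lin_ext R M (\<lambda>x. x) \<phi> = \<zero>\<^bsub>M\<^esub>"
  show "\<phi> g = \<zero>"
  proof (rule ccontr)
    assume "\<phi> g \<noteq> \<zero>"
    \<comment> \<open>The witnesses of dependence are the support of \<open>\<phi>\<close> as finite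
      set and \<open>\<phi>\<close> itself as coefficients.\<close>
    then have "lin_dep (carrier G)"
      using \<phi> unfolding lin_dep_def
      by (intro exI[of _ "{x. \<phi> x \<noteq> \<zero>}"] exI[of _ \<phi>] exI[of _ g])
        (auto simp: monoid_algebra_carrier_iff lin_ext_def lincomb_def)
    with li show False by simp
  qed
next
  show "carrier G \<subseteq> lin_ext R M (\<lambda>x. x) ` carrier (monoid_algebra R G)"
  proof
    fix g assume g: "g \<in> carrier G"
    have "lin_ext R M (\<lambda>x. x) (monoid_basis R g) = g"
      using sub g by (intro lin_ext_basis) auto
    then show "g \<in> lin_ext R M (\<lambda>x. x) ` carrier (monoid_algebra R G)"
      using R.monoid_basis_in[of g G, OF g] by (intro image_eqI[of _ _ "monoid_basis R g"]) auto
  qed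
qed

section \<open>Hopf algebras\<close>

locale hopf_coalgebra_basis = hopf_algebra K H
  for K :: "('a, 'r) ring_scheme" and H :: "('a, 'b, 'm) hopf_algebra_scheme" (structure) +
  fixes B :: "'b set"
  assumes coalgebra_basis: "coalgebra_basis K H B"
begin

sublocale HH: two_algebras K H H
  by unfold_locales

abbreviation "kk \<equiv> self_module K"
text \<open>Product and unit are placeholders that complete the bare set \<open>B\<close> to a
  monoid record.\<close>

abbreviation "B_set \<equiv> \<lparr>carrier = B, mult = (\<lambda>x y. x), one = undefined\<rparr>"

lemma module_H: "module K H"
  by unfold_locales

lemma module_kk: "module K kk"
  by (rule module_self)

lemma basis_B: "basis B"
  using coalgebra_basis by (simp add: coalgebra_basis_def)

lemma span_B: "span B = carrier H"
  using basis_B by (simp add: basis_def)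

sublocale B: module_basis K H B_set
  using basis_B by (intro module_basis_lin_indpt) (auto simp: basis_def)

lemma coords_B: "\<lbrakk>b \<in> B; d \<in> B\<rbrakk> \<Longrightarrow> B.coords b d = (if d = b then \<one>\<^bsub>K\<^esub> else \<zero>\<^bsub>K\<^esub>)"
  using B.coords_basis[of b] by (simp add: monoid_basis_def)

lemma coords_B_smult:
  "\<lbrakk>c \<in> carrier K; x \<in> carrier H\<rbrakk> \<Longrightarrow> B.coords (c \<odot> x) d = c \<otimes>\<^bsub>K\<^esub> B.coords x d"
  using module_hom_smult[OF B.coord_hom] by (simp add: self_module_simps)

lemma coords_B_closed: "x \<in> carrier H \<Longrightarrow> B.coords x d \<in> carrier K"
  using module_hom_in[OF B.coord_hom] by (simp add: self_module_simps)

lemma B_closed: "b \<in> B \<Longrightarrow> b \<in> carrier H"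
  using B.basis_closed by auto

lemma counit_closed: "x \<in> carrier H \<Longrightarrow> \<epsilon> x \<in> carrier K"
  using module_hom_in[OF counit_linear] by (simp add: self_module_simps)

lemma counit_smult:
  "\<lbrakk>c \<in> carrier K; x \<in> carrier H\<rbrakk> \<Longrightarrow> \<epsilon> (c \<odot> x) = c \<otimes>\<^bsub>K\<^esub> \<epsilon> x"
  using module_hom_smult[OF counit_linear] by (simp add: self_module_simps)

lemma counit_left_bilinear: "bilinear K H H H (\<lambda>a b. \<epsilon> a \<odot> b)"
  by (rule bilinear_comp[OF smult_bilinear counit_linear module_hom_id module_hom_id])

lemma counit_right_bilinear: "bilinear K H H H (\<lambda>a b. \<epsilon> b \<odot> a)"
  by (rule bilinear_flip[OF counit_left_bilinear])

text \<open>Read off the coordinate at \<open>b\<close>: it is one on the left, and on the right it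
  is \<open>k\<close> if \<open>d = b\<close> and zero otherwise.\<close>

lemma B_multiple_eq:
  assumes "b \<in> B" "d \<in> B" "k \<in> carrier K" "b = k \<odot> d"
  shows "b = d" "k = \<one>\<^bsub>K\<^esub>"
proof -
  have eq: "B.coords b x = k \<otimes>\<^bsub>K\<^esub> B.coords d x" for x
    using coords_B_smult[OF assms(3) B_closed[OF assms(2)]] assms(4) by simp
  show "b = d"
  proof (rule ccontr)
    assume "b \<noteq> d"
    with eq[of b] assms(1-3) show False
      by (simp add: coords_B)
  qed
  with eq[of b] assms(1-3) show "k = \<one>\<^bsub>K\<^esub>"
    by (simp add: coords_B)
qed

text \<open>Applying the two counit axioms to \<open>\<Delta> b = c b\<^sub>1 \<otimes> b\<^sub>2\<close> exhibits \<open>b\<close> as a multiple of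
  \<open>b\<^sub>2\<close> and of \<open>b\<^sub>1\<close>, so \<open>b = b\<^sub>1 = b\<^sub>2\<close> by linear independence.\<close>

lemma comult_B:
  assumes b: "b \<in> B"
  shows "\<epsilon> b \<noteq> \<zero>\<^bsub>K\<^esub>" "\<Delta> b = inv\<^bsub>K\<^esub> (\<epsilon> b) \<odot>\<^bsub>HH.T\<^esub> HH.pure b b"
proof -
  obtain c b1 b2 where c: "c \<in> carrier K" "b1 \<in> B" "b2 \<in> B"
    and \<Delta>: "\<Delta> b = c \<odot>\<^bsub>HH.T\<^esub> HH.pure b1 b2"
    using coalgebra_basis b unfolding coalgebra_basis_def by blast
  have lift: "tensor_lift K H \<beta> (\<Delta> b) = c \<odot> \<beta> b1 b2" if "bilinear K H H H \<beta>" for \<beta>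
    unfolding \<Delta> using c that B_closed
    by (simp add: module_hom_smult[OF HH.tensor_lift_hom[OF module_H that]] HH.pure_closed
        HH.tensor_lift_pure[OF module_H that])
  have eps: "\<epsilon> b1 \<in> carrier K" "\<epsilon> b2 \<in> carrier K"
    using c B_closed counit_closed by auto
  have l: "b = (c \<otimes>\<^bsub>K\<^esub> \<epsilon> b1) \<odot> b2"
    using counit_left[OF B_closed[OF b]] lift[OF counit_left_bilinear] c eps B_closed
    by (simp add: smult_assoc1)
  have r: "b = (c \<otimes>\<^bsub>K\<^esub> \<epsilon> b2) \<odot> b1"
    using counit_right[OF B_closed[OF b]] lift[OF counit_right_bilinear] c eps B_closed
    by (simp add: smult_assoc1)
  have eq: "b2 = b" "c \<otimes>\<^bsub>K\<^esub> \<epsilon> b1 = \<one>\<^bsub>K\<^esub>" "b1 = b"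
    using B_multiple_eq[OF b c(3) _ l] B_multiple_eq[OF b c(2) _ r] c eps by auto
  \<comment> \<open>The same comparison fixes the coefficient: \<open>c\<close> is inverse to
    \<open>\<epsilon> b\<close>, which is therefore nonzero.\<close>
  then have ce: "c \<otimes>\<^bsub>K\<^esub> \<epsilon> b = \<one>\<^bsub>K\<^esub>"
    by simp
  then show nz: "\<epsilon> b \<noteq> \<zero>\<^bsub>K\<^esub>"
    using c by auto
  have "inv\<^bsub>K\<^esub> (\<epsilon> b) = c"
    using ce c eps eq by (intro comm_inv_char) (auto simp: m_comm)
  then show "\<Delta> b = inv\<^bsub>K\<^esub> (\<epsilon> b) \<odot>\<^bsub>HH.T\<^esub> HH.pure b b"
    using \<Delta> eq by simp
qed

section \<open>Group-like elements as rescaled basis elements\<close>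

abbreviation "GH \<equiv> grouplike_group K H"

lemma grouplike_iff:
  "g \<in> carrier GH \<longleftrightarrow> g \<in> carrier H \<and> \<Delta> g = HH.pure g g \<and> \<epsilon> g = \<one>\<^bsub>K\<^esub>"
  by (simp add: grouplike_group_def)

lemma counit_B_unit:
  assumes "b \<in> B"
  shows "inv\<^bsub>K\<^esub> (\<epsilon> b) \<in> carrier K" "inv\<^bsub>K\<^esub> (\<epsilon> b) \<noteq> \<zero>\<^bsub>K\<^esub>"
    "inv\<^bsub>K\<^esub> (\<epsilon> b) \<otimes>\<^bsub>K\<^esub> \<epsilon> b = \<one>\<^bsub>K\<^esub>" "\<epsilon> b \<in> carrier K"
proof -
  have u: "\<epsilon> b \<in> Units K"
    using comult_B(1)[OF assms] counit_closed[OF B_closed[OF assms]] by (simp add: field_Units)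
  then show *: "inv\<^bsub>K\<^esub> (\<epsilon> b) \<in> carrier K" "inv\<^bsub>K\<^esub> (\<epsilon> b) \<otimes>\<^bsub>K\<^esub> \<epsilon> b = \<one>\<^bsub>K\<^esub>" "\<epsilon> b \<in> carrier K"
    by auto
  show "inv\<^bsub>K\<^esub> (\<epsilon> b) \<noteq> \<zero>\<^bsub>K\<^esub>"
    using * by auto
qed

abbreviation normalise :: "'b \<Rightarrow> 'b" where
  "normalise b \<equiv> inv\<^bsub>K\<^esub> (\<epsilon> b) \<odot> b"

text \<open>Linearity of \<open>\<Delta>\<close> contributes one inverse of
  \<open>\<epsilon> b\<close> and \<open>comult_B\<close> a second; bilinearity gives one to each
  tensor factor.\<close>

lemma normalise_grouplike:
  assumes b: "b \<in> B"
  shows "normalise b \<in> carrier GH"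
proof -
  note u = counit_B_unit[OF b] and bH = B_closed[OF b]
  have "\<Delta> (normalise b) = inv\<^bsub>K\<^esub> (\<epsilon> b) \<odot>\<^bsub>HH.T\<^esub> (inv\<^bsub>K\<^esub> (\<epsilon> b) \<odot>\<^bsub>HH.T\<^esub> HH.pure b b)"
    using module_hom_smult[OF comult_linear u(1) bH] comult_B(2)[OF b] by simp
  also have "\<dots> = HH.pure (normalise b) (normalise b)"
    using u bH by (simp add: bilinearD(4,5)[OF HH.pure_bilinear])
  finally show ?thesis
    using u bH by (simp add: grouplike_iff counit_smult)
qed

lemma B_eq_smult_normalise: "b \<in> B \<Longrightarrow> b = \<epsilon> b \<odot> normalise b"
  using counit_B_unit[of b] B_closed[of b]
  by (simp add: smult_assoc1[symmetric] m_comm)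

text \<open>The functional \<open>(\<kappa>\<^sub>b \<otimes> \<kappa>\<^sub>d) \<circ> \<Delta>\<close>, where \<open>\<kappa>\<close> denotes coordinates with respect to
  \<open>B\<close>.  Evaluated at a group-like element \<open>g\<close> it is \<open>\<kappa>\<^sub>b g \<kappa>\<^sub>d g\<close>, whereas linear
  extension from \<open>B\<close> gives \<open>0\<close> for \<open>b \<noteq> d\<close> and \<open>(\<epsilon> b)\<^sup>-\<^sup>1 \<kappa>\<^sub>b g\<close> for \<open>b = d\<close>.\<close>

definition coord_pair :: "'b \<Rightarrow> 'b \<Rightarrow> 'b \<Rightarrow> 'a" where
  "coord_pair b d x =
    tensor_lift K kk (\<lambda>x y. B.coords x b \<otimes>\<^bsub>K\<^esub> B.coords y d) (\<Delta> x)"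

lemma coord_bilinear: "bilinear K H H kk (\<lambda>x y. B.coords x b \<otimes>\<^bsub>K\<^esub> B.coords y d)"
  by (rule bilinear_comp[OF mult_bilinear B.coord_hom B.coord_hom module_hom_id])

lemma coord_pair_hom: "coord_pair b d \<in> module_hom K H kk"
  using module_hom_comp[OF comult_linear HH.tensor_lift_hom[OF module_kk coord_bilinear]]
  by (simp add: coord_pair_def[abs_def])

lemma coord_pair_grouplike:
  "g \<in> carrier GH \<Longrightarrow> coord_pair b d g = B.coords g b \<otimes>\<^bsub>K\<^esub> B.coords g d"
  by (simp add: coord_pair_def grouplike_iff HH.tensor_lift_pure[OF module_kk coord_bilinear])

lemma coord_pair_B:
  assumes x: "x \<in> B"
  shows "coord_pair b d x = inv\<^bsub>K\<^esub> (\<epsilon> x) \<otimes>\<^bsub>K\<^esub> (B.coords x b \<otimes>\<^bsub>K\<^esub> B.coords x d)"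
  using module_hom_smult[OF HH.tensor_lift_hom[OF module_kk coord_bilinear], of _ "HH.pure x x"]
    counit_B_unit[OF x] B_closed[OF x]
  by (simp add: coord_pair_def comult_B(2)[OF x] HH.pure_closed self_module_simps
      HH.tensor_lift_pure[OF module_kk coord_bilinear])

lemma coord_pair_neq:
  assumes "b \<in> B" "d \<in> B" "b \<noteq> d" "x \<in> carrier H"
  shows "coord_pair b d x = \<zero>\<^bsub>K\<^esub>"
proof -
  have "coord_pair b d x = \<zero>\<^bsub>kk\<^esub>"
  proof (rule B.hom_eqI[OF module_kk coord_pair_hom zero_hom[OF module_kk] _ assms(4)])
    fix y assume "y \<in> carrier B_set"
    then show "coord_pair b d y = \<zero>\<^bsub>kk\<^esub>"
      using assms counit_B_unit[of y] by (auto simp: coord_pair_B coords_B self_module_simps)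
  qed
  then show ?thesis by (simp add: self_module_simps)
qed

lemma coord_pair_same:
  assumes b: "b \<in> B" and x: "x \<in> carrier H"
  shows "coord_pair b b x = inv\<^bsub>K\<^esub> (\<epsilon> b) \<otimes>\<^bsub>K\<^esub> B.coords x b"
proof -
  interpret kk: module K kk by (rule module_kk)
  have "(\<lambda>x. inv\<^bsub>K\<^esub> (\<epsilon> b) \<odot>\<^bsub>kk\<^esub> B.coords x b) \<in> module_hom K H kk"
    by (rule module_hom_comp[OF B.coord_hom kk.smult_hom[OF counit_B_unit(1)[OF b]]])
  from B.hom_eqI[OF module_kk coord_pair_hom this _ x, of b b]
  have "coord_pair b b x = inv\<^bsub>K\<^esub> (\<epsilon> b) \<odot>\<^bsub>kk\<^esub> B.coords x b"
    using counit_B_unit b by (auto simp: coord_pair_B coords_B self_module_simps)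
  then show ?thesis by (simp add: self_module_simps)
qed

text \<open>Some coordinate of \<open>g\<close> is nonzero because \<open>\<epsilon> g = 1\<close>.
  The off-diagonal values of \<open>coord_pair\<close> make the product of any two different
  coordinates vanish, so only one survives; the diagonal value says that its square is the inverse
  of \<open>\<epsilon> b\<close> times itself, and cancelling determines it.\<close>

lemma grouplike_in_image:
  assumes g: "g \<in> carrier GH"
  shows "g \<in> normalise ` B"
proof -
  have gH: "g \<in> carrier H" and eg: "\<epsilon> g = \<one>\<^bsub>K\<^esub>"
    using g by (auto simp: grouplike_iff)
  have "\<exists>b. B.coords g b \<noteq> \<zero>\<^bsub>K\<^esub>"
  proof (rule ccontr)
    assume "\<not> (\<exists>b. B.coords g b \<noteq> \<zero>\<^bsub>K\<^esub>)"
    then have "g = \<zero>"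
      using B.comb_coords[OF gH] by (simp add: lin_ext_def)
    then have "\<epsilon> g = \<zero>\<^bsub>K\<^esub>"
      using mod_hom.f0_is_0[OF mod_homI[OF module_H module_kk counit_linear]]
      by (simp add: self_module_simps)
    with eg show False by simp
  qed
  then obtain b where b: "B.coords g b \<noteq> \<zero>\<^bsub>K\<^esub>" by blast
  have bB: "b \<in> B"
    using monoid_algebra_supp[OF B.coords_closed[OF gH] b] by simp
  note cl = coords_B_closed[OF gH]
  have "B.coords g d = \<zero>\<^bsub>K\<^esub>" if "d \<noteq> b" for d
  proof (cases "d \<in> B")
    case True
    then have "B.coords g b \<otimes>\<^bsub>K\<^esub> B.coords g d = \<zero>\<^bsub>K\<^esub>"
      using coord_pair_grouplike[OF g] coord_pair_neq[OF bB True _ gH] that by auto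
    then show ?thesis
      using b cl integral by blast
  next
    case False
    then show ?thesis
      using monoid_algebra_supp[OF B.coords_closed[OF gH]] by auto
  qed
  moreover have "B.coords g b = inv\<^bsub>K\<^esub> (\<epsilon> b)"
  proof -
    have "B.coords g b \<otimes>\<^bsub>K\<^esub> B.coords g b = inv\<^bsub>K\<^esub> (\<epsilon> b) \<otimes>\<^bsub>K\<^esub> B.coords g b"
      using coord_pair_grouplike[OF g, of b b] coord_pair_same[OF bB gH] by simp
    then show ?thesis
      using b cl counit_B_unit[OF bB] m_rcancel by blast
  qed
  ultimately have "{x. B.coords g x \<noteq> \<zero>\<^bsub>K\<^esub>} = {b}" "B.coords g b = inv\<^bsub>K\<^esub> (\<epsilon> b)"
    using counit_B_unit[OF bB] by auto
  then have "g = normalise b"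
    using B.comb_coords[OF gH] counit_B_unit[OF bB] B_closed[OF bB] by (simp add: lin_ext_def)
  with bB show ?thesis by simp
qed

lemma grouplikes_eq: "carrier GH = normalise ` B"
  using grouplike_in_image normalise_grouplike by auto

lemma grouplike_closed: "g \<in> carrier GH \<Longrightarrow> g \<in> carrier H"
  by (simp add: grouplike_iff)

text \<open>Rescaling by units preserves a basis, but the index set changes from \<open>B\<close> to
  its image. Independence is therefore tested with the coordinates of \<open>B\<close>, and spanning
  follows from \<open>b = \<epsilon> b \<odot> normalise b\<close>.\<close>

sublocale G: module_basis K H GH
proof (rule module_basisI)
  show sub: "carrier GH \<subseteq> carrier H"
    using grouplike_closed by auto
  let ?p = "lin_ext K H (\<lambda>x. x)"
  have p: "?p \<in> module_hom K (monoid_algebra K GH) H"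
    using sub by (intro lin_ext_hom) auto
  show "\<phi> g = \<zero>\<^bsub>K\<^esub>" if \<phi>: "\<phi> \<in> carrier (monoid_algebra K GH)" "?p \<phi> = \<zero>"
    and g: "g \<in> carrier GH" for \<phi> g
  proof -
    interpret kk: module K kk by (rule module_kk)
    obtain b where b: "b \<in> B" "g = normalise b"
      using g by (auto simp: grouplikes_eq)
    note u = counit_B_unit[OF b(1)]
    \<comment> \<open>The coordinate at \<open>b\<close> recovers the coefficient of
      \<open>g\<close> up to a unit; both sides are linear in \<open>\<phi>\<close>, so basis
      vectors suffice.\<close>
    have "B.coords (?p \<phi>) b = inv\<^bsub>K\<^esub> (\<epsilon> b) \<odot>\<^bsub>kk\<^esub> \<phi> g"
    proof (rule kk.hom_free_eqI[OF module_hom_comp[OF p B.coord_hom]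
          module_hom_comp[OF eval_hom kk.smult_hom[OF u(1)]] _ \<phi>(1)])
      fix h assume h: "h \<in> carrier GH"
      then obtain d where d: "d \<in> B" "h = normalise d"
        by (auto simp: grouplikes_eq)
      note ud = counit_B_unit[OF d(1)]
      have *: "B.coords (normalise d) b = inv\<^bsub>K\<^esub> (\<epsilon> d) \<otimes>\<^bsub>K\<^esub> (if b = d then \<one>\<^bsub>K\<^esub> else \<zero>\<^bsub>K\<^esub>)"
        if "d \<in> B" for d
        using that b(1) B_closed counit_B_unit by (simp add: coords_B_smult coords_B)
      \<comment> \<open>Different basis elements have different normalisations: the coordinate at
        \<open>b\<close> is a unit for one and zero for the other.\<close>
      have "g = h \<longleftrightarrow> b = d"
        using *[OF b(1)] *[OF d(1)] u(1,2) ud(1) b(2) d(2) by (cases "b = d") auto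
      moreover have "?p (monoid_basis K h) = h"
        using sub by (intro lin_ext_basis[OF _ h]) auto
      ultimately show "B.coords (?p (monoid_basis K h)) b =
          inv\<^bsub>K\<^esub> (\<epsilon> b) \<odot>\<^bsub>kk\<^esub> monoid_basis K h g"
        using *[OF d(1)] d(2) u ud by (auto simp: self_module_simps monoid_basis_def)
    qed
    moreover have "B.coords (?p \<phi>) b = \<zero>\<^bsub>K\<^esub>"
      using mod_hom.f0_is_0[OF mod_homI[OF module_H module_kk B.coord_hom]] \<phi>(2)
      by (simp add: self_module_simps)
    ultimately have "inv\<^bsub>K\<^esub> (\<epsilon> b) \<otimes>\<^bsub>K\<^esub> \<phi> g = \<zero>\<^bsub>K\<^esub>"
      by (simp add: self_module_simps)
    then show ?thesis
      using u monoid_algebra_val[OF \<phi>(1)] integral by blast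
  qed
  show "carrier H \<subseteq> ?p ` carrier (monoid_algebra K GH)"
  proof (rule lin_ext_id_surj[OF sub span_B])
    interpret F: module K "monoid_algebra K GH" by (rule module_monoid_algebra)
    show "B \<subseteq> ?p ` carrier (monoid_algebra K GH)"
    proof
      fix b assume b: "b \<in> B"
      let ?e = "monoid_basis K (normalise b)"
      have e: "?e \<in> carrier (monoid_algebra K GH)"
        by (rule monoid_basis_in[OF normalise_grouplike[OF b]])
      have "?p ?e = normalise b"
        using sub by (intro lin_ext_basis[OF _ normalise_grouplike[OF b]]) auto
      then have "?p (\<epsilon> b \<odot>\<^bsub>monoid_algebra K GH\<^esub> ?e) = b"
        using module_hom_smult[OF p _ e] counit_B_unit[OF b] B_eq_smult_normalise[OF b] by simp
      then show "b \<in> ?p ` carrier (monoid_algebra K GH)"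
        using F.smult_closed[OF counit_B_unit(4)[OF b] e] by (metis imageI)
    qed
  qed
qed

end

text \<open>\<open>hopf_iso\<close> refers to the tensor square of the Hopf algebra record, whereas
  the module theory is instantiated with the underlying monoid algebra. The construction reads the
  shared module fields, so both give the same tensor product.\<close>

lemma tensor_group_algebra:
  "tensor K (group_algebra K G) (group_algebra K G) =
    tensor K (monoid_algebra K G) (monoid_algebra K G)"
  "pure_tensor K (group_algebra K G) (group_algebra K G) =
    pure_tensor K (monoid_algebra K G) (monoid_algebra K G)"
proof -
  have F: "free_prod K (group_algebra K G) (group_algebra K G) =
      free_prod K (monoid_algebra K G) (monoid_algebra K G)"
    by (simp add: DirProd_def group_algebra_def Let_def)
  have "bilin_rels K (group_algebra K G) (group_algebra K G) =
      bilin_rels K (monoid_algebra K G) (monoid_algebra K G)"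
    unfolding bilin_rels_def F by (simp add: group_algebra_def Let_def)
  then have N: "tensor_null K (group_algebra K G) (group_algebra K G) =
      tensor_null K (monoid_algebra K G) (monoid_algebra K G)"
    by (simp add: tensor_null_def F)
  show "tensor K (group_algebra K G) (group_algebra K G) =
      tensor K (monoid_algebra K G) (monoid_algebra K G)"
    by (simp add: tensor_def F N)
  show "pure_tensor K (group_algebra K G) (group_algebra K G) =
      pure_tensor K (monoid_algebra K G) (monoid_algebra K G)"
    by (simp add: pure_tensor_def[abs_def] F N)
qed

section \<open>The group structure on the group-like elements\<close>

context hopf_coalgebra_basis
begin

lemma one_grouplike: "\<one> \<in> carrier GH"
proof -
  have "\<Delta> \<one> = HH.pure \<one> \<one>"
    using ring_hom_one[OF comult_ring_hom] by (simp add: HH.pure_one)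
  moreover have "\<epsilon> \<one> = \<one>\<^bsub>K\<^esub>"
    using ring_hom_one[OF counit_ring_hom] .
  ultimately show ?thesis
    by (simp add: grouplike_iff)
qed

lemma mult_grouplike:
  assumes g: "g \<in> carrier GH" and h: "h \<in> carrier GH"
  shows "g \<otimes> h \<in> carrier GH"
proof -
  have cl: "g \<in> carrier H" "h \<in> carrier H"
    using g h by (auto simp: grouplike_iff)
  have "\<Delta> (g \<otimes> h) = HH.pure (g \<otimes> h) (g \<otimes> h)"
    using ring_hom_mult[OF comult_ring_hom cl] g h cl by (simp add: grouplike_iff HH.pure_mult)
  moreover have "\<epsilon> (g \<otimes> h) = \<one>\<^bsub>K\<^esub>"
    using ring_hom_mult[OF counit_ring_hom cl] g h by (simp add: grouplike_iff)
  ultimately show ?thesis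
    using cl by (simp add: grouplike_iff)
qed

lemma mult_left_hom: "x \<in> carrier H \<Longrightarrow> (\<lambda>y. x \<otimes> y) \<in> module_hom K H H"
  by (rule module_homI) (auto simp: r_distr smult_mult_right)

lemma mult_right_hom: "y \<in> carrier H \<Longrightarrow> (\<lambda>x. x \<otimes> y) \<in> module_hom K H H"
  by (rule module_homI) (auto simp: l_distr smult_mult_left)

lemma H_mult_bilinear: "bilinear K H H H (\<lambda>x y. x \<otimes> y)"
  using mult_left_hom mult_right_hom by (simp add: bilinear_def)

lemma antipode_closed: "x \<in> carrier H \<Longrightarrow> antipode H x \<in> carrier H"
  by (rule module_hom_in[OF antipode_linear])

text \<open>At a group-like element the antipode axioms evaluate a lift at the single pure tensor
  \<open>g \<otimes> g\<close>, and the right-hand side is the unit because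
  \<open>\<epsilon> g = 1\<close>.\<close>

lemma antipode_grouplike_inverse:
  assumes g: "g \<in> carrier GH"
  shows "antipode H g \<otimes> g = \<one>" "g \<otimes> antipode H g = \<one>"
proof -
  have cl: "g \<in> carrier H" using g by (rule grouplike_closed)
  have l: "bilinear K H H H (\<lambda>a b. antipode H a \<otimes> b)"
    by (rule bilinear_comp[OF H_mult_bilinear antipode_linear module_hom_id module_hom_id])
  have r: "bilinear K H H H (\<lambda>a b. a \<otimes> antipode H b)"
    by (rule bilinear_comp[OF H_mult_bilinear module_hom_id antipode_linear module_hom_id])
  show "antipode H g \<otimes> g = \<one>"
    using antipode_left[OF cl] HH.tensor_lift_pure[OF module_H l cl cl] g
    by (simp add: grouplike_iff)
  show "g \<otimes> antipode H g = \<one>"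
    using antipode_right[OF cl] HH.tensor_lift_pure[OF module_H r cl cl] g
    by (simp add: grouplike_iff)
qed

text \<open>Writing \<open>S g = \<Sum> c\<^sub>h h\<close> with \<open>h\<close> group-like gives \<open>1 = \<Sum> c\<^sub>h (g h)\<close>, and by linear
  independence of the group-like elements one of the \<open>g h\<close> must be \<open>1\<close>.  This avoids the
  anti-comultiplicativity of \<open>S\<close>.\<close>

lemma antipode_grouplike:
  assumes g: "g \<in> carrier GH"
  shows "antipode H g \<in> carrier GH"
proof -
  have cl: "g \<in> carrier H" using g by (rule grouplike_closed)
  interpret kk: module K kk by (rule module_kk)
  note Sg = antipode_closed[OF cl]
  define \<psi> where "\<psi> = G.coords (antipode H g)"
  have \<psi>: "\<psi> \<in> carrier (monoid_algebra K GH)"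
    unfolding \<psi>_def by (rule G.coords_closed[OF Sg])
  \<comment> \<open>The functional "coefficient of the unit in \<open>g x\<close>" is one at the
    antipode of \<open>g\<close>. Were no \<open>g h\<close> equal to the unit, it would vanish on
    all group-likes and hence everywhere.\<close>
  have hom: "(\<lambda>x. G.coords (g \<otimes> x) \<one>) \<in> module_hom K H kk"
    by (rule module_hom_comp[OF mult_left_hom[OF cl] G.coord_hom])
  have eq: "lin_ext K kk (\<lambda>x. G.coords (g \<otimes> x) \<one>) \<psi> = \<one>\<^bsub>K\<^esub>"
    using G.hom_eq_lin_ext[OF module_kk hom Sg] antipode_grouplike_inverse[OF g]
    by (simp add: \<psi>_def G.coords_basis[OF one_grouplike] monoid_basis_def)
  have "\<exists>h\<in>carrier GH. g \<otimes> h = \<one>"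
  proof (rule ccontr)
    assume "\<not> ?thesis"
    then have "G.coords (g \<otimes> h) \<one> = \<zero>\<^bsub>kk\<^esub>" if "h \<in> carrier GH" for h
      using that G.coords_basis[OF mult_grouplike[OF g that]]
      by (auto simp: monoid_basis_def self_module_simps)
    then have "lin_ext K kk (\<lambda>x. G.coords (g \<otimes> x) \<one>) \<psi> = lin_ext K kk (\<lambda>x. \<zero>\<^bsub>kk\<^esub>) \<psi>"
      by (intro kk.lin_ext_cong[OF \<psi>]) auto
    also have "\<dots> = \<zero>\<^bsub>kk\<^esub>"
      unfolding lin_ext_def using monoid_algebra_val[OF \<psi>]
      by (intro kk.M.add.finprod_one_eqI) simp
    finally show False
      using eq by (simp add: self_module_simps)
  qed
  then obtain h where h: "h \<in> carrier GH" "g \<otimes> h = \<one>" by blast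
  \<comment> \<open>A left inverse and a right inverse of \<open>g\<close> coincide, so the antipode
    of \<open>g\<close> is the group-like \<open>h\<close>.\<close>
  have "antipode H g = antipode H g \<otimes> (g \<otimes> h)"
    using h Sg by simp
  also have "\<dots> = h"
    using antipode_grouplike_inverse[OF g] cl Sg grouplike_closed[OF h(1)]
    by (simp add: m_assoc[symmetric])
  finally show ?thesis using h by simp
qed

lemma grouplike_simps: "mult GH = mult H" "\<one>\<^bsub>GH\<^esub> = \<one>"
  by (simp_all add: grouplike_group_def)

lemma group_GH: "group GH"
proof (rule groupI)
  fix g assume "g \<in> carrier GH"
  then show "\<exists>h\<in>carrier GH. h \<otimes>\<^bsub>GH\<^esub> g = \<one>\<^bsub>GH\<^esub>"
    using antipode_grouplike antipode_grouplike_inverse by (auto simp: grouplike_simps)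
qed (simp_all add: grouplike_simps one_grouplike mult_grouplike grouplike_closed m_assoc)

lemma inv_GH: "g \<in> carrier GH \<Longrightarrow> inv\<^bsub>GH\<^esub> g = antipode H g"
  using antipode_grouplike antipode_grouplike_inverse
  by (intro group.inv_equality[OF group_GH]) (auto simp: grouplike_simps)

section \<open>The Hopf algebra isomorphism with the group algebra\<close>

abbreviation "KG \<equiv> monoid_algebra K GH"
abbreviation "L \<equiv> group_algebra K GH"

sublocale GA: magma_algebra K GH
  using mult_grouplike by unfold_locales (auto simp: grouplike_simps)

sublocale TL: two_modules K KG KG
  by unfold_locales

lemma L_simps:
  "carrier L = carrier KG" "mult L = mult KG" "\<one>\<^bsub>L\<^esub> = monoid_basis K \<one>" "add L = add KG"
  "smult L = smult KG"
  "\<Delta>\<^bsub>L\<^esub> = lin_ext K TL.T (\<lambda>g. TL.pure (monoid_basis K g) (monoid_basis K g))"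
  "\<epsilon>\<^bsub>L\<^esub> = lin_ext K kk (\<lambda>g. \<one>\<^bsub>K\<^esub>)"
  "antipode L = lin_ext K KG (\<lambda>g. monoid_basis K (inv\<^bsub>GH\<^esub> g))"
  by (simp_all add: group_algebra_def Let_def monoid_algebra_simps grouplike_simps)

text \<open>Both sides are linear in each of \<open>\<phi>\<close> and \<open>\<psi>\<close>, so two
  reductions to basis vectors leave the product of two group-likes, which is again one of the basis
  elements.\<close>

lemma comb_mult:
  assumes \<phi>: "\<phi> \<in> carrier KG" and \<psi>: "\<psi> \<in> carrier KG"
  shows "G.comb (\<phi> \<otimes>\<^bsub>KG\<^esub> \<psi>) = G.comb \<phi> \<otimes> G.comb \<psi>"
proof (rule hom_free_eqI[OF module_hom_comp[OF GA.monoid_algebra_mult_hom_left[OF \<psi>] G.comb_hom]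
      module_hom_comp[OF G.comb_hom mult_right_hom[OF module_hom_in[OF G.comb_hom \<psi>]]] _ \<phi>])
  fix x assume x: "x \<in> carrier GH"
  note ex = monoid_basis_in[OF x]
  show "G.comb (monoid_basis K x \<otimes>\<^bsub>KG\<^esub> \<psi>) = G.comb (monoid_basis K x) \<otimes> G.comb \<psi>"
  proof (rule hom_free_eqI[OF module_hom_comp[OF GA.monoid_algebra_mult_hom_right[OF ex] G.comb_hom]
        module_hom_comp[OF G.comb_hom mult_left_hom[OF module_hom_in[OF G.comb_hom ex]]] _ \<psi>])
    fix y assume y: "y \<in> carrier GH"
    show "G.comb (monoid_basis K x \<otimes>\<^bsub>KG\<^esub> monoid_basis K y) =
        G.comb (monoid_basis K x) \<otimes> G.comb (monoid_basis K y)"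
      using mult_grouplike[OF x y]
      by (simp add: GA.monoid_basis_mult[OF x y] G.comb_basis x y grouplike_simps)
  qed
qed

lemma coords_mult:
  assumes "x \<in> carrier H" "y \<in> carrier H"
  shows "G.coords (x \<otimes> y) = G.coords x \<otimes>\<^bsub>KG\<^esub> G.coords y"
proof -
  note c = G.coords_closed[OF assms(1)] G.coords_closed[OF assms(2)]
  \<comment> \<open>Multiplicativity passes to the inverse map: \<open>comb_mult\<close> rewrites
    the argument of the outer \<open>coords\<close> to \<open>x \<otimes> y\<close>.\<close>
  have "G.coords (G.comb (G.coords x \<otimes>\<^bsub>KG\<^esub> G.coords y)) = G.coords x \<otimes>\<^bsub>KG\<^esub> G.coords y"
    by (rule G.coords_comb[OF module_hom_in[OF GA.monoid_algebra_mult_hom_right[OF c(1)] c(2)]])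
  then show ?thesis
    by (simp add: comb_mult c G.comb_coords assms)
qed

text \<open>Both sides are linear in \<open>x\<close>, and at a group-like \<open>g\<close> both are
  the pure tensor of the basis vector of \<open>g\<close> with itself.\<close>

lemma coords_comult:
  assumes x: "x \<in> carrier H"
  shows "\<Delta>\<^bsub>L\<^esub> (G.coords x) = tensor_map K L L G.coords G.coords (\<Delta> x)"
proof -
  have d: "(\<lambda>g. TL.pure (monoid_basis K g) (monoid_basis K g)) \<in> carrier GH \<rightarrow> carrier TL.T"
    using monoid_basis_in by (intro funcsetI TL.pure_closed)
  have bil: "bilinear K H H TL.T (\<lambda>a b. TL.pure (G.coords a) (G.coords b))"
    by (rule bilinear_comp[OF TL.pure_bilinear G.coords_hom G.coords_hom module_hom_id])
  have "\<Delta>\<^bsub>L\<^esub> (G.coords x) = tensor_lift K TL.T (\<lambda>a b. TL.pure (G.coords a) (G.coords b)) (\<Delta> x)"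
    unfolding L_simps
  proof (rule G.hom_eqI[OF TL.module_tensor
        module_hom_comp[OF G.coords_hom TL.T.lin_ext_hom[OF d]]
        module_hom_comp[OF comult_linear HH.tensor_lift_hom[OF TL.module_tensor bil]] _ x])
    fix g assume g: "g \<in> carrier GH"
    then have "\<Delta> g = HH.pure g g" "g \<in> carrier H"
      by (auto simp: grouplike_iff)
    then show "lin_ext K TL.T (\<lambda>g. TL.pure (monoid_basis K g) (monoid_basis K g)) (G.coords g) =
        tensor_lift K TL.T (\<lambda>a b. TL.pure (G.coords a) (G.coords b)) (\<Delta> g)"
      by (simp add: HH.tensor_lift_pure[OF TL.module_tensor bil] G.coords_basis[OF g]
          TL.T.lin_ext_basis[OF d g])
  qed
  then show ?thesis
    by (simp add: tensor_map_def tensor_group_algebra)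
qed

lemma coords_counit:
  assumes x: "x \<in> carrier H"
  shows "\<epsilon>\<^bsub>L\<^esub> (G.coords x) = \<epsilon> x"
proof -
  interpret kk: module K kk by (rule module_kk)
  have d: "(\<lambda>g. \<one>\<^bsub>K\<^esub>) \<in> carrier GH \<rightarrow> carrier kk"
    by (simp add: self_module_simps)
  show ?thesis
    unfolding L_simps
    by (rule G.hom_eqI[OF module_kk module_hom_comp[OF G.coords_hom kk.lin_ext_hom[OF d]]
          counit_linear _ x])
      (simp add: G.coords_basis kk.lin_ext_basis[OF d] grouplike_iff)
qed

text \<open>On group-likes the antipode is the group inverse, so both sides send \<open>g\<close> to
  the basis vector of its inverse.\<close>

lemma coords_antipode:
  assumes x: "x \<in> carrier H"
  shows "antipode L (G.coords x) = G.coords (antipode H x)"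
proof -
  have d: "(\<lambda>g. monoid_basis K (inv\<^bsub>GH\<^esub> g)) \<in> carrier GH \<rightarrow> carrier KG"
    by (intro funcsetI monoid_basis_in group.inv_closed[OF group_GH])
  show ?thesis
    unfolding L_simps
    by (rule G.hom_eqI[OF module_monoid_algebra
          module_hom_comp[OF G.coords_hom GA.F.lin_ext_hom[OF d]]
          module_hom_comp[OF antipode_linear G.coords_hom] _ x])
      (simp add: G.coords_basis GA.F.lin_ext_basis[OF d] inv_GH antipode_grouplike)
qed

lemma coords_hopf_iso: "G.coords \<in> hopf_iso K H L"
proof -
  have "G.coords \<in> module_hom K H L"
    using G.coords_hom by (simp add: module_hom_def L_simps)
  moreover have "G.coords \<in> ring_hom H L"
  proof (rule ring_hom_memI)
    fix x y assume xy: "x \<in> carrier H" "y \<in> carrier H"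
    show "G.coords x \<in> carrier L"
      using G.coords_closed[OF xy(1)] by (simp only: L_simps)
    show "G.coords (x \<otimes> y) = G.coords x \<otimes>\<^bsub>L\<^esub> G.coords y"
      unfolding L_simps by (rule coords_mult[OF xy])
    show "G.coords (x \<oplus> y) = G.coords x \<oplus>\<^bsub>L\<^esub> G.coords y"
      unfolding L_simps by (rule module_hom_add[OF G.coords_hom xy])
  next
    show "G.coords \<one> = \<one>\<^bsub>L\<^esub>"
      unfolding L_simps by (rule G.coords_basis[OF one_grouplike])
  qed
  moreover have "bij_betw G.coords (carrier H) (carrier L)"
    unfolding L_simps by (rule G.bij_coords)
  ultimately show ?thesis
    unfolding hopf_iso_def using coords_comult coords_counit coords_antipode by blast
qed

end

theorem proposition6p10:
  fixes K :: "('a, 'r) ring_scheme"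
    and H :: "('a, 'b, 'm) hopf_algebra_scheme"
    and B :: "'b set"
  assumes "hopf_algebra K H"
    and "coalgebra_basis K H B"
  shows "(\<forall>b\<in>B. \<epsilon>\<^bsub>H\<^esub> b \<noteq> \<zero>\<^bsub>K\<^esub>) \<and>
    {inv\<^bsub>K\<^esub> (\<epsilon>\<^bsub>H\<^esub> b) \<odot>\<^bsub>H\<^esub> b | b. b \<in> B} = carrier (grouplike_group K H) \<and>
    hopf_isomorphic K H (group_algebra K (grouplike_group K H))"
proof -
  interpret hopf_coalgebra_basis K H B
    using assms by (intro hopf_coalgebra_basis.intro hopf_coalgebra_basis_axioms.intro)
  show ?thesis
    using comult_B(1) grouplikes_eq coords_hopf_iso
    by (auto simp: hopf_isomorphic_def)
qed

end
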